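(* Let $m,p,n\geq1$ and let $\mathcal{X}_1,\dots,\mathcal{X}_n\in\mathbb{C}^{m\times m\times p}$ be independent random Hermitian T-product tensors such that almost surely $\mathcal{X}_i\succeq\mathcal{O}$ and $\lambda_{\max}(\mathcal{X}_i)\leq 1$ for each $i$. Define $$\overline{\mu}_{\max}=\lambda_{\max}\left(\frac1n\sum_{i=1}^n\mathbb{E}\mathcal{X}_i\right),\qquad \overline{\mu}_{\min}=\lambda_{\min}\left(\frac1n\sum_{i=1}^n\mathbb{E}\mathcal{X}_i\right).$$ Then $$\Pr\left(\lambda_{\max}\left(\frac1n\sum_{i=1}^n\mathcal{X}_i\right)\geq\theta\right)\leq mp\,e^{-n\,\mathfrak{D}(\theta\,\Vert\,\overline{\mu}_{\max})}\quad\text{for }\overline{\mu}_{\max}\leq\theta\leq1,$$ and $$\Pr\left(\lambda_{\min}\left(\frac1n\sum_{i=1}^n\mathcal{X}_i\right)\leq\theta\right)\leq mp\,e^{-n\,\mathfrak{D}(\theta\,\Vert\,\overline{\mu}_{\min})}\quad\text{for }0\leq\theta\leq\overline{\mu}_{\min}.$$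
   Context: For $\mathcal{A}\in\mathbb{C}^{m\times n\times p}$ with frontal slices $A^{(1)},\dots,A^{(p)}$, $\mathrm{bcirc}(\mathcal{A})\in\mathbb{C}^{mp\times np}$ is the block circulant matrix whose $(r,s)$ block is $A^{(((r-s)\bmod p)+1)}$. The conjugate transpose $\mathcal{A}^{\mathrm H}$ is obtained by conjugate-transposing every frontal slice and reversing the order of slices $2,\dots,p$, so $\mathrm{bcirc}(\mathcal{A}^{\mathrm H})=\mathrm{bcirc}(\mathcal{A})^{\mathrm H}$. $\mathcal{A}\in\mathbb{C}^{m\times m\times p}$ is Hermitian if $\mathcal{A}^{\mathrm H}=\mathcal{A}$; its eigenvalues are the $mp$ eigenvalues of $\mathrm{bcirc}(\mathcal{A})$, with largest/smallest $\lambda_{\max}$/$\lambda_{\min}$. For Hermitian $\mathcal{A},\mathcal{B}$, $\mathcal{A}\preceq\mathcal{B}$ means $\mathrm{bcirc}(\mathcal{B}-\mathcal{A})$ is positive semidefinite; $\mathcal{O}$ is the zero tensor. Expectation of a random tensor is taken entrywise. For $c,d\in[0,1]$ the binary information divergence is $\mathfrak{D}(c\Vert d)=c\log\frac{c}{d}+(1-c)\log\frac{1-c}{1-d}$ (with the usual conventions $0\log 0=0$). *)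

theory Defs
  imports "HOL-Probability.Probability" "Jordan_Normal_Form.Char_Poly"
begin

text \<open>A third-order tensor in C^(m x m x p) is represented by its entry function
  T i j k with 0-based indices i < m, j < m, k < p (k indexes the frontal slices).\<close>

type_synonym tensor = "nat \<Rightarrow> nat \<Rightarrow> nat \<Rightarrow> complex"

definition bcirc :: "nat \<Rightarrow> nat \<Rightarrow> tensor \<Rightarrow> complex mat" where
  "bcirc m p T = mat (m * p) (m * p)
     (\<lambda>(r, s). T (r mod m) (s mod m) (nat ((int (r div m) - int (s div m)) mod int p)))"

text \<open>Conjugate transpose: conjugate-transpose every slice, reverse slices 2..p.\<close>
definition tensor_ct :: "nat \<Rightarrow> tensor \<Rightarrow> tensor" where
  "tensor_ct p T = (\<lambda>i j k. cnj (T j i ((p - k) mod p)))"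

definition tensor_hermitian :: "nat \<Rightarrow> nat \<Rightarrow> tensor \<Rightarrow> bool" where
  "tensor_hermitian m p T = (\<forall>i<m. \<forall>j<m. \<forall>k<p. tensor_ct p T i j k = T i j k)"

definition psd_mat :: "complex mat \<Rightarrow> bool" where
  "psd_mat A = (A \<in> carrier_mat (dim_row A) (dim_row A) \<and>
     (\<forall>i<dim_row A. \<forall>j<dim_row A. A $$ (i, j) = cnj (A $$ (j, i))) \<and>
     (\<forall>x :: nat \<Rightarrow> complex.
        (let q = (\<Sum>i<dim_row A. \<Sum>j<dim_row A. cnj (x i) * A $$ (i, j) * x j)
         in Im q = 0 \<and> Re q \<ge> 0)))"

definition tensor_zero :: tensor where "tensor_zero = (\<lambda>i j k. 0)"

definition tensor_le :: "nat \<Rightarrow> nat \<Rightarrow> tensor \<Rightarrow> tensor \<Rightarrow> bool" where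
  "tensor_le m p A B = psd_mat (bcirc m p (\<lambda>i j k. B i j k - A i j k))"

text \<open>Eigenvalues of a tensor = eigenvalues of bcirc; for Hermitian tensors they are real.\<close>
definition lambda_max :: "nat \<Rightarrow> nat \<Rightarrow> tensor \<Rightarrow> real" where
  "lambda_max m p T = Max (Re ` {k. eigenvalue (bcirc m p T) k})"

definition lambda_min :: "nat \<Rightarrow> nat \<Rightarrow> tensor \<Rightarrow> real" where
  "lambda_min m p T = Min (Re ` {k. eigenvalue (bcirc m p T) k})"

definition xlogxy :: "real \<Rightarrow> real \<Rightarrow> ereal" where
  "xlogxy c d = (if c = 0 then 0 else if d = 0 then \<infinity> else ereal (c * ln (c / d)))"

definition bin_div :: "real \<Rightarrow> real \<Rightarrow> ereal" where
  "bin_div c d = xlogxy c d + xlogxy (1 - c) (1 - d)"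

text \<open>exp(-x) for x in (-\<infinity>, \<infinity>], with exp(-\<infinity>) = 0.\<close>
definition exp_neg :: "ereal \<Rightarrow> real" where
  "exp_neg x = (if x = \<infinity> then 0 else exp (- real_of_ereal x))"

end

theory Submission
  imports Defs "Jordan_Normal_Form.Spectral_Radius"
begin

text \<open>
  Laplace transform argument, with \<open>bcirc\<close> turning tensors into \<open>mp \<times> mp\<close> matrices.
  For \<open>X\<close> with spectrum in \<open>[0, 1]\<close> and real \<open>t\<close> of either sign, \<open>t X \<le> log (1 + (e\<^sup>t - 1) X)\<close>,
  so both tails reduce to bounding \<open>E tr exp (\<Sum>\<^sub>i log A\<^sub>i)\<close> with \<open>A\<^sub>i = 1 + (e\<^sup>t - 1) X\<^sub>i\<close>.
  Lieb's theorem (concavity of \<open>A \<mapsto> tr exp (H + log A)\<close>) moves the expectations inside the logarithms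
  one independent summand at a time. It comes from the Gibbs variational principle and the joint
  convexity of relative entropy; the latter holds because \<open>log\<close> is an integral of functions
  \<open>(t - a)\<^sup>2 / ((1 - s) t + s a)\<close> whose trace versions are suprema of functionals linear in both matrices.
  Only the mean of the \<open>E X\<^sub>i\<close> enters afterwards, since \<open>\<Sum>\<^sub>i log A\<^sub>i\<close> is bounded by tangents of the
  scalar logarithm. Matrices are functions on index pairs, considered only below the dimension \<open>N\<close>.
\<close>

section \<open>Spectral decomposition of Hermitian matrices\<close>

text \<open>The trace exponential of a sum of non-commuting matrices does not factor, and the
  Golden-Thompson inequality reaches only two summands. Concavity lets one summand be averaged while
  the others stay frozen. Jensen's inequality is not invoked for this: for each \<epsilon> > 0 a
  pair of linear functionals minorizes relative entropy everywhere and comes within \<epsilon> of it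
  at the single pair (E T, E A), where T = exp (H + log A). Integrating this linear bound and
  applying the Gibbs inequality at E T gives the expectation form directly. Finite averages over
  Riemann nodes take the place of an operator integral for the logarithm.

  Eigenvectors are picked by an arbitrary choice, so their dependence on the sample point is
  uncontrolled. Measurability is recovered by approximating continuous functions of a matrix by
  polynomials in its entries. Since the spectrum lies in [0, 1] only almost surely, the logarithm is
  clamped outside that interval; it is then continuous and bounded on the whole line, which settles
  both measurability and integrability.\<close>

type_synonym cmat = "nat \<Rightarrow> nat \<Rightarrow> complex"

definition ip :: "nat \<Rightarrow> (nat \<Rightarrow> complex) \<Rightarrow> (nat \<Rightarrow> complex) \<Rightarrow> complex" where
  "ip N x y = (\<Sum>r<N. cnj (x r) * y r)"

definition herm :: "nat \<Rightarrow> cmat \<Rightarrow> bool" where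
  "herm N A \<longleftrightarrow> (\<forall>r<N. \<forall>s<N. A r s = cnj (A s r))"

definition orthonormal :: "nat \<Rightarrow> (nat \<Rightarrow> nat \<Rightarrow> complex) \<Rightarrow> bool" where
  "orthonormal N u \<longleftrightarrow> (\<forall>i<N. \<forall>j<N. ip N (u i) (u j) = of_bool (i = j))"

lemma ip_self: "ip N x x = of_real (\<Sum>r<N. (cmod (x r))\<^sup>2)"
  by (simp add: ip_def complex_norm_square mult.commute del: of_real_power)

lemma cnj_ip: "cnj (ip N x y) = ip N y x"
  by (simp add: ip_def mult.commute)

lemma eigenvector_exists:
  fixes A :: cmat
  assumes "N > 0"
  shows "\<exists>x e. (\<exists>r<N. x r \<noteq> 0) \<and> (\<forall>r<N. (\<Sum>s<N. A r s * x s) = e * x r)"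
proof -
  let ?A = "mat N N (\<lambda>(r, s). A r s)"
  have carr: "?A \<in> carrier_mat N N" by simp
  obtain e where "eigenvalue ?A e"
    using spectrum_non_empty[OF carr assms] by (auto simp: spectrum_def)
  then obtain v where v: "v \<in> carrier_vec N" "v \<noteq> 0\<^sub>v N" "?A *\<^sub>v v = e \<cdot>\<^sub>v v"
    by (auto simp: eigenvalue_def eigenvector_def)
  have "\<exists>r<N. vec_index v r \<noteq> 0"
    using v(1,2) by (metis carrier_vecD eq_vecI index_zero_vec(1) index_zero_vec(2))
  moreover have "(\<Sum>s<N. A r s * vec_index v s) = e * vec_index v r" if "r < N" for r
  proof -
    have "vec_index (?A *\<^sub>v v) r = (\<Sum>s<N. A r s * vec_index v s)"
      using that v(1) by (simp add: scalar_prod_def atLeast0LessThan)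
    then show ?thesis using v that by simp
  qed
  ultimately show ?thesis by blast
qed

lemma sum_of_bool_mult:
  fixes f :: "nat \<Rightarrow> 'a::semiring_1"
  assumes "i < N"
  shows "(\<Sum>r<N. of_bool (r = i) * f r) = f i" "(\<Sum>r<N. of_bool (i = r) * f r) = f i"
    "(\<Sum>r<N. f r * of_bool (r = i)) = f i" "(\<Sum>r<N. f r * of_bool (i = r)) = f i"
proof -
  have "(\<Sum>r<N. g r) = f i" if "\<And>r. g r = (if r = i then f r else 0)" for g
    using assms by (simp add: that)
  note sum_eq = this
  show "(\<Sum>r<N. of_bool (r = i) * f r) = f i" "(\<Sum>r<N. of_bool (i = r) * f r) = f i"
    "(\<Sum>r<N. f r * of_bool (r = i)) = f i" "(\<Sum>r<N. f r * of_bool (i = r)) = f i"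
    by (rule sum_eq; simp)+
qed

text \<open>Householder reflection exchanging \<open>v\<close> with the first unit vector; when \<open>v\<close> is
  that unit vector, the convention \<open>2 / 0 = 0\<close> makes it the identity.\<close>

lemma orthonormal_basis_first:
  assumes N: "N > 0" and v1: "ip N v v = 1" and v0: "v 0 \<in> \<real>"
  shows "\<exists>w. orthonormal N w \<and>
    (\<forall>r<N. \<forall>s<N. (\<Sum>i<N. w i r * cnj (w i s)) = of_bool (r = s)) \<and> (\<forall>r<N. w 0 r = v r)"
proof -
  define h where "h r = v r - of_bool (r = 0)" for r
  define c where "c = 2 / ip N h h"
  define w where "w j r = of_bool (r = j) - c * h r * cnj (h j)" for j r
  \<comment> \<open>Reality of \<open>v 0\<close> enters here: over the complex numbers the
    reflection along \<open>v - e_0\<close> carries \<open>e_0\<close> to \<open>v\<close> only if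
    their inner product is real.\<close>
  have hh: "ip N h h = 2 - 2 * v 0"
  proof -
    have "ip N h h = (\<Sum>r<N. cnj (v r) * v r - (of_bool (r = 0) * v r + cnj (v r) * of_bool (r = 0))
        + of_bool (r = 0) * 1)"
      unfolding ip_def h_def by (intro sum.cong) (auto simp: algebra_simps)
    also have "\<dots> = ip N v v - (v 0 + cnj (v 0)) + 1"
      unfolding sum.distrib sum_subtractf ip_def sum_of_bool_mult[OF N] by simp
    also have "cnj (v 0) = v 0" using v0 by (simp add: Reals_cnj_iff)
    finally show ?thesis using v1 by simp
  qed
  have cr: "cnj c = c" unfolding c_def by (simp add: cnj_ip)
  \<comment> \<open>This identity makes the reflection unitary. It survives
    \<open>ip N h h = 0\<close>, where \<open>c = 0\<close>.\<close>
  have c2: "c * c * ip N h h = 2 * c" by (simp add: c_def)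
  have hhs: "(\<Sum>r<N. h r * cnj (h r)) = ip N h h" by (simp add: ip_def mult.commute)
  have orth: "ip N (w i) (w j) = of_bool (i = j)" if i: "i < N" and j: "j < N" for i j
  proof -
    have "ip N (w i) (w j) = (\<Sum>r<N. of_bool (r = i) * of_bool (r = j)
        - of_bool (r = i) * (c * h r * cnj (h j)) - (c * cnj (h r) * h i) * of_bool (r = j)
        + c * c * h i * cnj (h j) * (h r * cnj (h r)))"
      unfolding ip_def w_def by (intro sum.cong) (auto simp: algebra_simps cr)
    also have "\<dots> = of_bool (i = j) - c * h i * cnj (h j) - c * cnj (h j) * h i
        + h i * cnj (h j) * (c * c * ip N h h)"
      unfolding sum.distrib sum_subtractf sum_of_bool_mult[OF i] sum_of_bool_mult[OF j]
        sum_distrib_left[symmetric] hhs by (simp add: algebra_simps)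
    also have "\<dots> = of_bool (i = j)" unfolding c2 by (simp add: algebra_simps)
    finally show ?thesis .
  qed
  have herm: "cnj (w i r) = w r i" for i r
    unfolding w_def by (auto simp: cr algebra_simps)
  have "(\<Sum>i<N. w i r * cnj (w i s)) = of_bool (r = s)" if "r < N" "s < N" for r s
  proof -
    have "(\<Sum>i<N. w i r * cnj (w i s)) = ip N (w r) (w s)"
      unfolding ip_def by (intro sum.cong refl) (metis herm complex_cnj_cnj)
    then show ?thesis using orth[OF that] by simp
  qed
  moreover have "w 0 r = v r" if "r < N" for r
  proof (cases "ip N h h = 0")
    case True
    then have "(\<Sum>r<N. (cmod (h r))\<^sup>2) = 0" by (simp only: ip_self of_real_eq_0_iff)
    then have "h r = 0" using that by (simp add: sum_nonneg_eq_0_iff)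
    then show ?thesis by (simp add: w_def h_def)
  next
    case False
    have "cnj (v 0) = v 0" using v0 by (simp add: Reals_cnj_iff)
    then have "cnj (h 0) = - ip N h h / 2" unfolding hh by (simp add: h_def field_simps)
    then have "c * cnj (h 0) = - 1" using False by (simp add: c_def)
    moreover have "w 0 r = of_bool (r = 0) - (c * cnj (h 0)) * h r" by (simp add: w_def)
    ultimately have "w 0 r = of_bool (r = 0) + h r" by simp
    then show ?thesis by (simp add: h_def)
  qed
  ultimately show ?thesis using orth unfolding orthonormal_def by blast
qed

lemma herm_eigenvalue_real:
  assumes "herm N A" "ip N v v = 1" "\<And>r. r < N \<Longrightarrow> (\<Sum>s<N. A r s * v s) = e * v r"
  shows "e \<in> \<real>"
proof -
  have e: "e = (\<Sum>r<N. cnj (v r) * (\<Sum>s<N. A r s * v s))"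
  proof -
    have "(\<Sum>r<N. cnj (v r) * (\<Sum>s<N. A r s * v s)) = (\<Sum>r<N. e * (cnj (v r) * v r))"
      using assms(3) by (intro sum.cong refl) simp
    also have "\<dots> = e * ip N v v" by (simp add: ip_def sum_distrib_left)
    finally show ?thesis using assms(2) by simp
  qed
  have "cnj e = (\<Sum>r<N. \<Sum>s<N. v r * (cnj (A r s) * cnj (v s)))"
    by (subst e) (simp add: sum_distrib_left)
  also have "\<dots> = (\<Sum>r<N. \<Sum>s<N. v r * (A s r * cnj (v s)))"
    using assms(1) by (intro sum.cong refl) (metis complex_cnj_cnj herm_def lessThan_iff)
  also have "\<dots> = (\<Sum>s<N. \<Sum>r<N. v r * (A s r * cnj (v s)))" by (rule sum.swap)
  also have "\<dots> = (\<Sum>r<N. cnj (v r) * (\<Sum>s<N. A r s * v s))"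
    by (simp add: sum_distrib_left mult_ac)
  also note e[symmetric]
  finally show ?thesis by (simp add: Reals_cnj_iff)
qed

lemma normalized_eigenvector:
  fixes A :: cmat
  assumes "N > 0"
  shows "\<exists>v e. ip N v v = 1 \<and> v 0 \<in> \<real> \<and> (\<forall>r<N. (\<Sum>s<N. A r s * v s) = e * v r)"
proof -
  obtain x e where x: "\<exists>r<N. x r \<noteq> 0" "\<forall>r<N. (\<Sum>s<N. A r s * x s) = e * x r"
    using eigenvector_exists[OF assms] by blast
  define S where "S = (\<Sum>r<N. (cmod (x r))\<^sup>2)"
  have S: "S > 0"
    unfolding S_def using x(1) by (auto intro!: sum_pos2)
  \<comment> \<open>The phase rotates the first coordinate onto the real line, as the Householder
    reflection requires. The case \<open>x 0 = 0\<close> is separate because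
    \<open>sgn 0 = 0\<close> would annihilate the vector.\<close>
  define c where "c = (if x 0 = 0 then 1 else cnj (sgn (x 0))) / of_real (sqrt S)"
  define v where "v r = c * x r" for r
  have "cmod c = 1 / sqrt S" using S by (simp add: c_def norm_divide norm_sgn)
  then have c2: "(cmod c)\<^sup>2 = 1 / S" using S by (simp add: power_divide)
  have "ip N v v = of_real ((cmod c)\<^sup>2 * S)"
    unfolding ip_self v_def S_def by (simp add: norm_mult power_mult_distrib sum_distrib_left)
  also have "\<dots> = 1" using c2 S by simp
  finally have "ip N v v = 1" .
  moreover have "v 0 \<in> \<real>"
    unfolding v_def c_def by (auto simp: Reals_cnj_iff sgn_eq mult_ac)
  moreover have "(\<Sum>s<N. A r s * v s) = e * v r" if "r < N" for r
  proof -
    have "(\<Sum>s<N. A r s * v s) = c * (\<Sum>s<N. A r s * x s)"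
      by (simp add: v_def sum_distrib_left mult_ac)
    then show ?thesis using x(2) that by (simp add: v_def)
  qed
  ultimately show ?thesis by blast
qed

text \<open>Deflation: one eigenvector is completed to an orthonormal basis \<open>w\<close>. In
  that basis the Hermitian matrix splits into a scalar and a Hermitian block of size one less, to
  which the induction hypothesis applies.\<close>

lemma herm_eigenbasis:
  "herm N A \<Longrightarrow> \<exists>lam u. orthonormal N u \<and>
     (\<forall>i<N. \<forall>r<N. (\<Sum>s<N. A r s * u i s) = complex_of_real (lam i) * u i r)"
proof (induction N arbitrary: A)
  case 0
  then show ?case by (simp add: orthonormal_def)
next
  case (Suc N)
  let ?n = "Suc N"
  obtain v e where v: "ip ?n v v = 1" "v 0 \<in> \<real>"
      and ve: "\<And>r. r < ?n \<Longrightarrow> (\<Sum>s<?n. A r s * v s) = e * v r"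
    using normalized_eigenvector[of ?n A] by blast
  obtain w where ow: "orthonormal ?n w"
      and cw: "\<And>r s. r < ?n \<Longrightarrow> s < ?n \<Longrightarrow> (\<Sum>i<?n. w i r * cnj (w i s)) = of_bool (r = s)"
      and w0: "\<And>r. r < ?n \<Longrightarrow> w 0 r = v r"
    using orthonormal_basis_first[OF _ v] by blast
  have ow': "ip ?n (w i) (w j) = of_bool (i = j)" if "i < ?n" "j < ?n" for i j
    using ow that by (simp add: orthonormal_def)
  have "e \<in> \<real>" using herm_eigenvalue_real[OF Suc.prems v(1) ve] .
  then obtain e' where e': "e = of_real e'" by (auto elim: Reals_cases)
  define Aw where "Aw j r = (\<Sum>s<?n. A r s * w j s)" for j r
  define B where "B i j = ip ?n (w i) (Aw j)" for i j
  have Bherm: "B i j = cnj (B j i)" for i j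
  proof -
    have "B i j = (\<Sum>r<?n. \<Sum>s<?n. cnj (w i r) * (A r s * w j s))"
      by (simp add: B_def ip_def Aw_def sum_distrib_left del: sum.lessThan_Suc)
    also have "\<dots> = (\<Sum>r<?n. \<Sum>s<?n. cnj (w i r) * (cnj (A s r) * w j s))"
      using Suc.prems by (intro sum.cong refl) (metis herm_def lessThan_iff)
    also have "\<dots> = (\<Sum>s<?n. \<Sum>r<?n. cnj (w i r) * (cnj (A s r) * w j s))" by (rule sum.swap)
    also have "\<dots> = cnj (B j i)"
      by (simp add: B_def ip_def Aw_def sum_distrib_left mult_ac del: sum.lessThan_Suc)
    finally show ?thesis .
  qed
  have "Aw 0 r = e * w 0 r" if "r < ?n" for r
    using ve[OF that] w0 that by (simp add: Aw_def del: sum.lessThan_Suc)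
  then have "B i 0 = e * ip ?n (w i) (w 0)" for i
    unfolding B_def ip_def by (simp add: sum_distrib_left mult_ac del: sum.lessThan_Suc)
  then have Bi0: "B i 0 = e * of_bool (i = 0)" if "i < ?n" for i
    using ow'[OF that] by simp
  \<comment> \<open>The eigenvector equation clears the first column; Hermitian symmetry then clears
    the first row as well.\<close>
  have B0j: "B 0 (Suc j) = 0" if "j < N" for j
    using Bherm[of 0 "Suc j"] Bi0[of "Suc j"] that by simp
  have Awexp: "Aw j r = (\<Sum>i<?n. w i r * B i j)" if "r < ?n" for j r
  proof -
    have "(\<Sum>i<?n. w i r * B i j) = (\<Sum>i<?n. \<Sum>s<?n. w i r * cnj (w i s) * Aw j s)"
      by (simp add: B_def ip_def sum_distrib_left mult_ac del: sum.lessThan_Suc)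
    also have "\<dots> = (\<Sum>s<?n. \<Sum>i<?n. w i r * cnj (w i s) * Aw j s)" by (rule sum.swap)
    also have "\<dots> = (\<Sum>s<?n. of_bool (r = s) * Aw j s)"
      using cw that by (intro sum.cong refl) (simp del: sum.lessThan_Suc flip: sum_distrib_right)
    also have "\<dots> = Aw j r" by (rule sum_of_bool_mult(2)[OF that])
    finally show ?thesis by simp
  qed
  have "herm N (\<lambda>i j. B (Suc i) (Suc j))" unfolding herm_def using Bherm by blast
  from Suc.IH[OF this] obtain lam' u' where ou: "orthonormal N u'"
    and eu: "\<And>i r. i < N \<Longrightarrow> r < N \<Longrightarrow>
      (\<Sum>s<N. B (Suc r) (Suc s) * u' i s) = complex_of_real (lam' i) * u' i r" by blast
  define lam where "lam i = (case i of 0 \<Rightarrow> e' | Suc i \<Rightarrow> lam' i)" for i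
  \<comment> \<open>Eigenvectors of the block are coefficient vectors with respect to
    \<open>w 1, ..., w N\<close>; here they are carried back to the original coordinates.\<close>
  define u where "u i r = (case i of 0 \<Rightarrow> w 0 r | Suc i \<Rightarrow> \<Sum>j<N. w (Suc j) r * u' i j)" for i r
  have u0: "u 0 = w 0" and uS: "u (Suc i) r = (\<Sum>j<N. w (Suc j) r * u' i j)" for i r
    by (auto simp: u_def)
  have ipS: "ip ?n x (u (Suc i)) = (\<Sum>j<N. ip ?n x (w (Suc j)) * u' i j)" for x i
  proof -
    have "ip ?n x (u (Suc i)) = (\<Sum>r<?n. \<Sum>j<N. cnj (x r) * w (Suc j) r * u' i j)"
      by (simp add: ip_def uS sum_distrib_left mult_ac del: sum.lessThan_Suc)
    also have "\<dots> = (\<Sum>j<N. \<Sum>r<?n. cnj (x r) * w (Suc j) r * u' i j)" by (rule sum.swap)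
    finally show ?thesis by (simp add: ip_def sum_distrib_right del: sum.lessThan_Suc)
  qed
  have o00: "ip ?n (u 0) (u 0) = 1" using ow'[of 0 0] by (simp add: u0)
  have o0S: "ip ?n (u 0) (u (Suc i)) = 0" for i
    unfolding ipS u0 by (intro sum.neutral) (auto simp: ow')
  have oS0: "ip ?n (u (Suc i)) (u 0) = 0" for i
    using o0S cnj_ip by (metis complex_cnj_zero)
  have oSS: "ip ?n (u (Suc i)) (u (Suc i')) = of_bool (i = i')" if "i < N" "i' < N" for i i'
  proof -
    have *: "ip ?n (u (Suc i)) (w (Suc j)) = cnj (u' i j)" if "j < N" for j
    proof -
      have "ip ?n (w (Suc j)) (u (Suc i)) = (\<Sum>k<N. of_bool (j = k) * u' i k)"
        unfolding ipS using that by (intro sum.cong) (auto simp: ow')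
      also have "\<dots> = u' i j" by (rule sum_of_bool_mult(2)[OF that])
      finally show ?thesis by (metis cnj_ip)
    qed
    have "ip ?n (u (Suc i)) (u (Suc i')) = (\<Sum>j<N. cnj (u' i j) * u' i' j)"
      unfolding ipS using * by simp
    also have "\<dots> = of_bool (i = i')" using ou that by (simp add: orthonormal_def ip_def)
    finally show ?thesis .
  qed
  have "orthonormal ?n u"
    unfolding orthonormal_def
  proof (intro allI impI)
    fix i j assume "i < ?n" "j < ?n"
    then show "ip ?n (u i) (u j) = of_bool (i = j)"
      using o00 o0S oS0 oSS by (cases i; cases j) auto
  qed
  moreover have ev: "(\<Sum>s<?n. A r s * u i s) = complex_of_real (lam i) * u i r"
    if i: "i < ?n" and r: "r < ?n" for i r
  proof (cases i)
    case 0
    then show ?thesis using ve[OF r] w0 r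
      by (simp add: u0 lam_def e' del: sum.lessThan_Suc)
  next
    case (Suc k)
    with i have k: "k < N" by simp
    have "(\<Sum>s<?n. A r s * u i s) = (\<Sum>s<?n. \<Sum>j<N. A r s * w (Suc j) s * u' k j)"
      by (simp add: Suc uS sum_distrib_left mult_ac del: sum.lessThan_Suc)
    also have "\<dots> = (\<Sum>j<N. \<Sum>s<?n. A r s * w (Suc j) s * u' k j)" by (rule sum.swap)
    also have "\<dots> = (\<Sum>j<N. Aw (Suc j) r * u' k j)"
      by (simp add: Aw_def sum_distrib_right del: sum.lessThan_Suc)
    also have "\<dots> = (\<Sum>j<N. \<Sum>l<N. w (Suc l) r * (B (Suc l) (Suc j) * u' k j))"
    proof (intro sum.cong refl)
      fix j assume "j \<in> {..<N}"
      then show "Aw (Suc j) r * u' k j = (\<Sum>l<N. w (Suc l) r * (B (Suc l) (Suc j) * u' k j))"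
        unfolding Awexp[OF r] sum.lessThan_Suc_shift using B0j
        by (simp add: sum_distrib_right sum_distrib_left mult_ac)
    qed
    also have "\<dots> = (\<Sum>l<N. \<Sum>j<N. w (Suc l) r * (B (Suc l) (Suc j) * u' k j))" by (rule sum.swap)
    also have "\<dots> = (\<Sum>l<N. w (Suc l) r * (complex_of_real (lam' k) * u' k l))"
      using eu[OF k] by (simp flip: sum_distrib_left)
    also have "\<dots> = complex_of_real (lam i) * u i r"
      by (simp add: Suc uS lam_def sum_distrib_left mult_ac)
    finally show ?thesis .
  qed
  ultimately have "orthonormal ?n u \<and>
     (\<forall>i<?n. \<forall>r<?n. (\<Sum>s<?n. A r s * u i s) = complex_of_real (lam i) * u i r)" by iprover
  then show ?case by (intro exI)
qed

text \<open>A left inverse of a square matrix is also a right inverse, so \<open>N\<close>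
  orthonormal vectors already resolve the identity.\<close>

lemma orthonormal_complete:
  assumes "orthonormal N u" "r < N" "s < N"
  shows "(\<Sum>i<N. u i r * cnj (u i s)) = of_bool (r = s)"
proof -
  let ?U = "mat N N (\<lambda>(r, i). u i r)" and ?V = "mat N N (\<lambda>(i, r). cnj (u i r))"
  have "?V * ?U = 1\<^sub>m N"
    using assms(1) by (intro eq_matI) (auto simp: scalar_prod_def orthonormal_def ip_def atLeast0LessThan)
  then have "?U * ?V = 1\<^sub>m N"
    by (rule mat_mult_left_right_inverse[rotated 2]) auto
  then have "index_mat (?U * ?V) (r, s) = index_mat (1\<^sub>m N) (r, s)" by simp
  then show ?thesis using assms(2,3) by (simp add: scalar_prod_def atLeast0LessThan)
qed

text \<open>A relation with explicit eigenvalues and eigenvectors, because several matrices must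
  share one basis (functions and affine images of \<open>A\<close>) and a decomposition is not
  unique.\<close>

definition sdec :: "nat \<Rightarrow> cmat \<Rightarrow> (nat \<Rightarrow> real) \<Rightarrow> (nat \<Rightarrow> nat \<Rightarrow> complex) \<Rightarrow> bool" where
  "sdec N A lam u \<longleftrightarrow> orthonormal N u \<and>
     (\<forall>r<N. \<forall>s<N. A r s = (\<Sum>i<N. complex_of_real (lam i) * u i r * cnj (u i s)))"

theorem spectral_decomposition:
  assumes "herm N A"
  shows "\<exists>lam u. sdec N A lam u"
proof -
  obtain lam u where ou: "orthonormal N u"
    and ev: "\<And>i r. i < N \<Longrightarrow> r < N \<Longrightarrow> (\<Sum>s<N. A r s * u i s) = complex_of_real (lam i) * u i r"
    using herm_eigenbasis[OF assms] by blast
  have "A r s = (\<Sum>i<N. complex_of_real (lam i) * u i r * cnj (u i s))" if "r < N" "s < N" for r s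
  proof -
    have "(\<Sum>i<N. complex_of_real (lam i) * u i r * cnj (u i s))
        = (\<Sum>i<N. \<Sum>t<N. A r t * (u i t * cnj (u i s)))"
      using ev that by (simp add: sum_distrib_right mult.assoc flip: ev)
    also have "\<dots> = (\<Sum>t<N. \<Sum>i<N. A r t * (u i t * cnj (u i s)))" by (rule sum.swap)
    also have "\<dots> = (\<Sum>t<N. A r t * of_bool (t = s))"
      using orthonormal_complete[OF ou _ that(2)] by (simp flip: sum_distrib_left)
    also have "\<dots> = A r s" by (rule sum_of_bool_mult(3)[OF that(2)])
    finally show ?thesis by (rule sym)
  qed
  then show ?thesis using ou unfolding sdec_def by blast
qed

section \<open>Quadratic forms, traces and overlaps of eigenbases\<close>

definition bil :: "nat \<Rightarrow> cmat \<Rightarrow> (nat \<Rightarrow> complex) \<Rightarrow> (nat \<Rightarrow> complex) \<Rightarrow> complex" where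
  "bil N A x y = (\<Sum>r<N. \<Sum>s<N. cnj (x r) * A r s * y s)"

definition qf :: "nat \<Rightarrow> cmat \<Rightarrow> (nat \<Rightarrow> complex) \<Rightarrow> real" where
  "qf N A x = Re (bil N A x x)"

definition mm :: "nat \<Rightarrow> cmat \<Rightarrow> cmat \<Rightarrow> cmat" where
  "mm N A B r s = (\<Sum>q<N. A r q * B q s)"

lemma bil_ip: "bil N A x y = ip N x (\<lambda>r. \<Sum>s<N. A r s * y s)"
  by (simp add: bil_def ip_def sum_distrib_left mult_ac)

lemma bil_add: "bil N (\<lambda>r s. A r s + B r s) x y = bil N A x y + bil N B x y"
  by (simp add: bil_def algebra_simps sum.distrib)

lemma bil_scale: "bil N (\<lambda>r s. c * A r s) x y = c * bil N A x y"
  by (simp add: bil_def sum_distrib_left mult_ac)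

lemma bil_sum: "bil N (\<lambda>r s. \<Sum>i\<in>I. A i r s) x y = (\<Sum>i\<in>I. bil N (A i) x y)"
proof (induction I rule: infinite_finite_induct)
  case (insert i I)
  then show ?case by (simp add: bil_add)
qed (simp_all add: bil_def)

lemma qf_sum: "qf N (\<lambda>r s. \<Sum>i\<in>I. A i r s) x = (\<Sum>i\<in>I. qf N (A i) x)"
  by (simp add: qf_def bil_sum)

lemma qf_cong: "(\<And>r s. r < N \<Longrightarrow> s < N \<Longrightarrow> A r s = B r s) \<Longrightarrow> qf N A x = qf N B x"
  unfolding qf_def bil_def by (intro arg_cong[where f = Re] sum.cong refl) auto

lemma herm_add: "herm N A \<Longrightarrow> herm N B \<Longrightarrow> herm N (\<lambda>r s. A r s + B r s)"
  unfolding herm_def complex_cnj_add by (intro allI impI arg_cong2[where f = "(+)"]) blast+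

lemma herm_sum:
  assumes "\<And>i. i \<in> I \<Longrightarrow> herm N (A i)"
  shows "herm N (\<lambda>r s. \<Sum>i\<in>I. A i r s)"
  using assms unfolding herm_def cnj_sum by (intro allI impI sum.cong refl) blast

lemma orthonormal_parseval:
  assumes "orthonormal N u"
  shows "(\<Sum>i<N. cnj (ip N (u i) x) * ip N (u i) y) = ip N x y"
proof -
  have "(\<Sum>i<N. cnj (ip N (u i) x) * ip N (u i) y)
      = (\<Sum>i<N. \<Sum>r<N. \<Sum>s<N. cnj (x r) * y s * (u i r * cnj (u i s)))"
    unfolding ip_def cnj_sum sum_product by (simp add: mult_ac)
  also have "\<dots> = (\<Sum>r<N. \<Sum>i<N. \<Sum>s<N. cnj (x r) * y s * (u i r * cnj (u i s)))"
    by (rule sum.swap)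
  also have "\<dots> = (\<Sum>r<N. \<Sum>s<N. \<Sum>i<N. cnj (x r) * y s * (u i r * cnj (u i s)))"
    by (intro sum.cong refl sum.swap)
  also have "\<dots> = (\<Sum>r<N. \<Sum>s<N. cnj (x r) * y s * of_bool (r = s))"
    using orthonormal_complete[OF assms]
    by (intro sum.cong refl) (simp flip: sum_distrib_left del: sum_mult_of_bool_eq)
  also have "\<dots> = (\<Sum>r<N. cnj (x r) * y r)"
    by (intro sum.cong refl sum_of_bool_mult(4)) simp
  finally show ?thesis by (simp add: ip_def)
qed

lemma orthonormal_parseval_norm:
  assumes "orthonormal N u"
  shows "(\<Sum>i<N. (cmod (ip N (u i) x))\<^sup>2) = Re (ip N x x)"
proof -
  have "complex_of_real (\<Sum>i<N. (cmod (ip N (u i) x))\<^sup>2) = ip N x x"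
    using orthonormal_parseval[OF assms, of x x]
    unfolding of_real_sum complex_norm_square by (simp add: mult.commute)
  then show ?thesis by (metis Re_complex_of_real)
qed

lemma orthonormal_entry_le:
  assumes "orthonormal N u" "i < N" "r < N"
  shows "cmod (u i r) \<le> 1"
proof -
  have "(cmod (u i r))\<^sup>2 \<le> (\<Sum>r<N. (cmod (u i r))\<^sup>2)"
    by (rule member_le_sum) (use assms in auto)
  also have "\<dots> = Re (ip N (u i) (u i))" by (simp add: ip_self del: of_real_sum)
  also have "\<dots> = 1" using assms by (simp add: orthonormal_def)
  finally show ?thesis by (simp add: power_le_one_iff abs_square_le_1)
qed

lemma sdec_orthonormal: "sdec N A lam u \<Longrightarrow> orthonormal N u"
  by (simp add: sdec_def)

lemma sdec_norm: "sdec N A lam u \<Longrightarrow> i < N \<Longrightarrow> ip N (u i) (u i) = 1"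
  by (simp add: sdec_def orthonormal_def)

lemma sdec_eigen:
  assumes "sdec N A lam u" "i < N" "r < N"
  shows "(\<Sum>s<N. A r s * u i s) = lam i * u i r"
proof -
  have "(\<Sum>s<N. A r s * u i s) = (\<Sum>s<N. \<Sum>j<N. lam j * u j r * (cnj (u j s) * u i s))"
    using assms by (simp add: sdec_def sum_distrib_left sum_distrib_right mult_ac)
  also have "\<dots> = (\<Sum>j<N. \<Sum>s<N. lam j * u j r * (cnj (u j s) * u i s))" by (rule sum.swap)
  also have "\<dots> = (\<Sum>j<N. lam j * u j r * of_bool (j = i))"
    using assms(1,2) by (simp add: sdec_def orthonormal_def ip_def flip: sum_distrib_left
        del: sum_mult_of_bool_eq)
  also have "\<dots> = lam i * u i r" by (rule sum_of_bool_mult(3)[OF assms(2)])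
  finally show ?thesis .
qed

lemma sdec_bil:
  assumes "sdec N A lam u"
  shows "bil N A x y = (\<Sum>i<N. lam i * (cnj (ip N (u i) x) * ip N (u i) y))"
proof -
  have "bil N A x y = (\<Sum>r<N. \<Sum>s<N. \<Sum>i<N. lam i * (cnj (x r) * u i r) * (cnj (u i s) * y s))"
    using assms by (simp add: bil_def sdec_def sum_distrib_left sum_distrib_right mult_ac)
  also have "\<dots> = (\<Sum>r<N. \<Sum>i<N. \<Sum>s<N. lam i * (cnj (x r) * u i r) * (cnj (u i s) * y s))"
    by (intro sum.cong refl sum.swap)
  also have "\<dots> = (\<Sum>i<N. \<Sum>r<N. \<Sum>s<N. lam i * (cnj (x r) * u i r) * (cnj (u i s) * y s))"
    by (rule sum.swap)
  also have "\<dots> = (\<Sum>i<N. lam i * (ip N x (u i) * ip N (u i) y))"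
    by (simp add: ip_def sum_product sum_distrib_left mult_ac)
  finally show ?thesis by (simp add: cnj_ip)
qed

lemma sdec_qf:
  assumes "sdec N A lam u"
  shows "qf N A x = (\<Sum>i<N. lam i * (cmod (ip N (u i) x))\<^sup>2)"
proof -
  have "bil N A x x = complex_of_real (\<Sum>i<N. lam i * (cmod (ip N (u i) x))\<^sup>2)"
    unfolding sdec_bil[OF assms] of_real_sum of_real_mult complex_norm_square
    by (simp add: mult_ac)
  then show ?thesis by (simp add: qf_def del: of_real_sum)
qed

lemma sdec_qf_eigenvector:
  assumes "sdec N A lam u" "i < N"
  shows "qf N A (u i) = lam i"
proof -
  have "bil N A (u i) (u i) = (\<Sum>r<N. cnj (u i r) * (lam i * u i r))"
    unfolding bil_ip ip_def using sdec_eigen[OF assms] by simp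
  also have "\<dots> = lam i * ip N (u i) (u i)" by (simp add: ip_def sum_distrib_left mult_ac)
  finally show ?thesis using sdec_norm[OF assms] by (simp add: qf_def)
qed

lemma sdec_herm: "sdec N A lam u \<Longrightarrow> herm N A"
  unfolding sdec_def herm_def by (auto simp: mult_ac intro!: sum.cong)

lemma sdec_trace:
  assumes "sdec N A lam u"
  shows "(\<Sum>r<N. A r r) = complex_of_real (\<Sum>i<N. lam i)"
proof -
  have "(\<Sum>r<N. A r r) = (\<Sum>r<N. \<Sum>i<N. lam i * (cnj (u i r) * u i r))"
    using assms by (simp add: sdec_def mult_ac)
  also have "\<dots> = (\<Sum>i<N. \<Sum>r<N. lam i * (cnj (u i r) * u i r))" by (rule sum.swap)
  also have "\<dots> = (\<Sum>i<N. lam i * ip N (u i) (u i))" by (simp add: ip_def sum_distrib_left)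
  also have "\<dots> = (\<Sum>i<N. complex_of_real (lam i))" using sdec_norm[OF assms] by simp
  finally show ?thesis by simp
qed

lemma sdec_trace_mult:
  assumes "sdec N A a u"
  shows "(\<Sum>r<N. \<Sum>s<N. A r s * B s r) = (\<Sum>i<N. a i * bil N B (u i) (u i))"
proof -
  have "(\<Sum>r<N. \<Sum>s<N. A r s * B s r) = (\<Sum>s<N. \<Sum>r<N. A r s * B s r)" by (rule sum.swap)
  also have "\<dots> = (\<Sum>s<N. \<Sum>r<N. \<Sum>i<N. a i * (cnj (u i s) * B s r * u i r))"
    using assms by (simp add: sdec_def sum_distrib_left sum_distrib_right mult_ac)
  also have "\<dots> = (\<Sum>s<N. \<Sum>i<N. \<Sum>r<N. a i * (cnj (u i s) * B s r * u i r))"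
    by (intro sum.cong refl sum.swap)
  also have "\<dots> = (\<Sum>i<N. \<Sum>s<N. \<Sum>r<N. a i * (cnj (u i s) * B s r * u i r))"
    by (rule sum.swap)
  finally show ?thesis by (simp add: bil_def sum_distrib_left)
qed

text \<open>The squared overlaps of the two eigenbases form a doubly stochastic array. Through them,
  trace expressions in two non-commuting matrices become weighted sums over pairs of eigenvalues, to
  which scalar inequalities apply.\<close>

lemma sdec_trace_mult_sdec:
  assumes "sdec N A a u" "sdec N B b v"
  shows "Re (\<Sum>r<N. \<Sum>s<N. A r s * B s r) = (\<Sum>i<N. \<Sum>j<N. a i * b j * (cmod (ip N (u i) (v j)))\<^sup>2)"
proof -
  have sw: "cmod (ip N (v j) (u i)) = cmod (ip N (u i) (v j))" for i j
    by (metis cnj_ip complex_mod_cnj)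
  have "Re (\<Sum>r<N. \<Sum>s<N. A r s * B s r) = (\<Sum>i<N. a i * qf N B (u i))"
    unfolding sdec_trace_mult[OF assms(1)] by (simp add: qf_def)
  then show ?thesis
    by (simp add: sdec_qf[OF assms(2)] sw sum_distrib_left mult.assoc)
qed

text \<open>Coefficients with respect to a mixed pair of bases. If \<open>u\<close> is an eigenbasis
  of \<open>T\<close> and \<open>v\<close> one of \<open>A\<close>, they diagonalize left
  multiplication by \<open>T\<close> and right multiplication by \<open>A\<close> simultaneously:
  these two operations commute even when \<open>T\<close> and \<open>A\<close> do not.\<close>

lemma bil_parseval:
  assumes "orthonormal N u" "orthonormal N v"
  shows "(\<Sum>i<N. \<Sum>j<N. cnj (bil N Y (u i) (v j)) * bil N Z (u i) (v j))
    = (\<Sum>r<N. \<Sum>s<N. cnj (Y r s) * Z r s)"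
proof -
  let ?y = "\<lambda>j r. \<Sum>s<N. Y r s * v j s" and ?z = "\<lambda>j r. \<Sum>s<N. Z r s * v j s"
  have "(\<Sum>i<N. \<Sum>j<N. cnj (bil N Y (u i) (v j)) * bil N Z (u i) (v j))
      = (\<Sum>j<N. \<Sum>i<N. cnj (ip N (u i) (?y j)) * ip N (u i) (?z j))"
    unfolding bil_ip by (rule sum.swap)
  also have "\<dots> = (\<Sum>j<N. \<Sum>r<N. cnj (?y j r) * ?z j r)"
    unfolding orthonormal_parseval[OF assms(1)] by (simp add: ip_def)
  also have "\<dots> = (\<Sum>r<N. \<Sum>j<N. cnj (?y j r) * ?z j r)" by (rule sum.swap)
  also have "\<dots> = (\<Sum>r<N. \<Sum>j<N. cnj (ip N (v j) (\<lambda>s. cnj (Z r s))) * ip N (v j) (\<lambda>s. cnj (Y r s)))"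
    by (intro sum.cong refl) (simp add: ip_def mult.commute)
  also have "\<dots> = (\<Sum>r<N. \<Sum>s<N. cnj (Y r s) * Z r s)"
    unfolding orthonormal_parseval[OF assms(2)] by (simp add: ip_def mult.commute)
  finally show ?thesis .
qed

lemma bil_mm_left:
  assumes "sdec N T t u" "i < N"
  shows "bil N (mm N T Y) (u i) y = t i * bil N Y (u i) y"
proof -
  have "bil N (mm N T Y) (u i) y = (\<Sum>r<N. \<Sum>s<N. \<Sum>q<N. cnj (u i r) * T r q * (Y q s * y s))"
    by (simp add: bil_def mm_def sum_distrib_left sum_distrib_right mult_ac)
  also have "\<dots> = (\<Sum>r<N. \<Sum>q<N. \<Sum>s<N. cnj (u i r) * T r q * (Y q s * y s))"
    by (intro sum.cong refl sum.swap)
  also have "\<dots> = bil N T (u i) (\<lambda>q. \<Sum>s<N. Y q s * y s)"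
    by (simp add: bil_def sum_distrib_left)
  also have "\<dots> = (\<Sum>j<N. t j * (cnj (ip N (u j) (u i)) * ip N (u j) (\<lambda>q. \<Sum>s<N. Y q s * y s)))"
    by (rule sdec_bil[OF assms(1)])
  also have "\<dots> = (\<Sum>j<N. of_bool (j = i) * (t j * ip N (u j) (\<lambda>q. \<Sum>s<N. Y q s * y s)))"
    using assms by (intro sum.cong refl) (auto simp: sdec_def orthonormal_def)
  also have "\<dots> = t i * ip N (u i) (\<lambda>q. \<Sum>s<N. Y q s * y s)"
    by (rule sum_of_bool_mult(1)[OF assms(2)])
  finally show ?thesis by (simp add: bil_ip)
qed

lemma bil_mm_right:
  assumes "sdec N A a v" "j < N"
  shows "bil N (mm N Y A) x (v j) = a j * bil N Y x (v j)"
proof -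
  have "bil N (mm N Y A) x (v j) = (\<Sum>r<N. \<Sum>s<N. \<Sum>q<N. cnj (x r) * Y r q * (A q s * v j s))"
    by (simp add: bil_def mm_def sum_distrib_left sum_distrib_right mult_ac)
  also have "\<dots> = (\<Sum>r<N. \<Sum>q<N. \<Sum>s<N. cnj (x r) * Y r q * (A q s * v j s))"
    by (intro sum.cong refl sum.swap)
  also have "\<dots> = (\<Sum>r<N. \<Sum>q<N. cnj (x r) * Y r q * (a j * v j q))"
    using sdec_eigen[OF assms] by (simp flip: sum_distrib_left)
  also have "\<dots> = a j * bil N Y x (v j)"
    by (simp add: bil_def sum_distrib_left mult_ac)
  finally show ?thesis .
qed

section \<open>Functional calculus and the trace exponential\<close>

definition eigv :: "nat \<Rightarrow> cmat \<Rightarrow> nat \<Rightarrow> real" where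
  "eigv N A = fst (SOME p. sdec N A (fst p) (snd p))"

definition eigu :: "nat \<Rightarrow> cmat \<Rightarrow> nat \<Rightarrow> nat \<Rightarrow> complex" where
  "eigu N A = snd (SOME p. sdec N A (fst p) (snd p))"

text \<open>The chosen eigenvectors have no controlled dependence on \<open>A\<close>; measurability
  is established only for the entries of \<open>mfun\<close> and for \<open>trexp\<close>, never for
  \<open>eigv\<close> or \<open>eigu\<close>.\<close>

definition mfun :: "nat \<Rightarrow> (real \<Rightarrow> real) \<Rightarrow> cmat \<Rightarrow> cmat" where
  "mfun N f A r s = (\<Sum>i<N. complex_of_real (f (eigv N A i)) * eigu N A i r * cnj (eigu N A i s))"

definition trexp :: "nat \<Rightarrow> cmat \<Rightarrow> real" where
  "trexp N K = (\<Sum>i<N. exp (eigv N K i))"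

lemma sdec_eig:
  assumes "herm N A"
  shows "sdec N A (eigv N A) (eigu N A)"
proof -
  have "\<exists>p. sdec N A (fst p) (snd p)" using spectral_decomposition[OF assms] by auto
  from someI_ex[OF this] show ?thesis by (simp add: eigv_def eigu_def)
qed

lemma sdec_mfun:
  "herm N A \<Longrightarrow> sdec N (mfun N f A) (\<lambda>i. f (eigv N A i)) (eigu N A)"
  using sdec_eig[of N A] by (simp add: sdec_def mfun_def)

lemma herm_mfun: "herm N A \<Longrightarrow> herm N (mfun N f A)"
  using sdec_mfun sdec_herm by blast

lemma sdec_affine:
  assumes "sdec N X x u" "\<And>r s. r < N \<Longrightarrow> s < N \<Longrightarrow> A r s = of_bool (r = s) + complex_of_real g * X r s"
  shows "sdec N A (\<lambda>i. 1 + g * x i) u"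
proof -
  have "A r s = (\<Sum>i<N. complex_of_real (1 + g * x i) * u i r * cnj (u i s))" if "r < N" "s < N" for r s
  proof -
    have "(\<Sum>i<N. complex_of_real (1 + g * x i) * u i r * cnj (u i s))
      = (\<Sum>i<N. u i r * cnj (u i s)) + g * (\<Sum>i<N. x i * u i r * cnj (u i s))"
      by (simp add: algebra_simps sum.distrib sum_distrib_left)
    also have "\<dots> = of_bool (r = s) + g * X r s"
      using orthonormal_complete[OF sdec_orthonormal[OF assms(1)] that] assms(1) that
      by (simp add: sdec_def)
    finally show ?thesis using assms(2)[OF that] by simp
  qed
  then show ?thesis using assms(1) by (simp add: sdec_def)
qed

text \<open>All functions of \<open>A\<close> are diagonal in one basis, so a scalar comparison with
  a line on the spectrum passes to quadratic forms. The affine side is linear in \<open>A\<close>,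
  hence can be added up over several non-commuting matrices at the same vector.\<close>

lemma qf_mfun_ge_affine:
  assumes "herm N A" "\<And>i. i < N \<Longrightarrow> \<alpha> + \<beta> * eigv N A i \<le> f (eigv N A i)"
  shows "\<alpha> * Re (ip N x x) + \<beta> * qf N A x \<le> qf N (mfun N f A) x"
proof -
  have "\<alpha> * Re (ip N x x) + \<beta> * qf N A x
      = (\<Sum>i<N. (\<alpha> + \<beta> * eigv N A i) * (cmod (ip N (eigu N A i) x))\<^sup>2)"
    unfolding sdec_qf[OF sdec_eig[OF assms(1)]]
      orthonormal_parseval_norm[OF sdec_orthonormal[OF sdec_eig[OF assms(1)]], symmetric]
    by (simp add: algebra_simps sum.distrib sum_distrib_left)
  also have "\<dots> \<le> (\<Sum>i<N. f (eigv N A i) * (cmod (ip N (eigu N A i) x))\<^sup>2)"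
    using assms(2) by (intro sum_mono mult_right_mono) auto
  also have "\<dots> = qf N (mfun N f A) x" by (rule sdec_qf[OF sdec_mfun[OF assms(1)], symmetric])
  finally show ?thesis .
qed

lemma qf_mfun_le_affine:
  assumes "herm N A" "\<And>i. i < N \<Longrightarrow> f (eigv N A i) \<le> \<alpha> + \<beta> * eigv N A i"
  shows "qf N (mfun N f A) x \<le> \<alpha> * Re (ip N x x) + \<beta> * qf N A x"
proof -
  have "qf N (mfun N f A) x = (\<Sum>i<N. f (eigv N A i) * (cmod (ip N (eigu N A i) x))\<^sup>2)"
    by (rule sdec_qf[OF sdec_mfun[OF assms(1)]])
  also have "\<dots> \<le> (\<Sum>i<N. (\<alpha> + \<beta> * eigv N A i) * (cmod (ip N (eigu N A i) x))\<^sup>2)"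
    using assms(2) by (intro sum_mono mult_right_mono) auto
  also have "\<dots> = \<alpha> * Re (ip N x x) + \<beta> * qf N A x"
    unfolding sdec_qf[OF sdec_eig[OF assms(1)]]
      orthonormal_parseval_norm[OF sdec_orthonormal[OF sdec_eig[OF assms(1)]], symmetric]
    by (simp add: algebra_simps sum.distrib sum_distrib_left)
  finally show ?thesis .
qed

text \<open>The largest eigenvalue dominates the quadratic form, and its exponential is one term of
  the trace. This exchanges an extreme eigenvalue for a trace, the quantity whose expectation Lieb's
  theorem controls.\<close>

lemma exp_qf_le_trexp:
  assumes K: "herm N K" and x: "ip N x x = 1" and "N > 0"
  shows "exp (qf N K x) \<le> trexp N K"
proof -
  define k where "k = Max (eigv N K ` {..<N})"
  have "qf N K x = (\<Sum>i<N. eigv N K i * (cmod (ip N (eigu N K i) x))\<^sup>2)"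
    by (rule sdec_qf[OF sdec_eig[OF K]])
  also have "\<dots> \<le> (\<Sum>i<N. k * (cmod (ip N (eigu N K i) x))\<^sup>2)"
    by (intro sum_mono mult_right_mono) (auto simp: k_def)
  also have "\<dots> = k"
    using orthonormal_parseval_norm[OF sdec_orthonormal[OF sdec_eig[OF K]], of x] x
    by (simp flip: sum_distrib_left)
  finally have "exp (qf N K x) \<le> exp k" by simp
  also have "k \<in> eigv N K ` {..<N}"
    unfolding k_def using assms(3) by (intro Max_in) auto
  then obtain i where "i < N" "k = eigv N K i" by auto
  then have "exp k \<le> trexp N K"
    unfolding trexp_def by (auto intro!: member_le_sum)
  finally show ?thesis .
qed

section \<open>Joint convexity of relative entropy\<close>

text \<open>For positive \<open>t\<close> and \<open>a\<close> this equals
  \<open>t * (t - a) / ((1 - s) * t + s * a)\<close>, the \<open>s\<close>-derivative of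
  \<open>- t * ln ((1 - s) * t + s * a)\<close>. Writing it as a linear term plus a square over a
  linear form exposes its joint convexity in \<open>(t, a)\<close>.\<close>

definition hquo :: "real \<Rightarrow> real \<Rightarrow> real \<Rightarrow> real" where
  "hquo s t a = (t - a) + s * ((t - a)\<^sup>2 / ((1 - s) * t + s * a))"

text \<open>\<open>t * ln (t / a)\<close> is the integral of \<open>hquo s t a\<close> over \<open>s \<in> [0, 1]\<close>, and the
  integrand increases in \<open>s\<close>, so left Riemann sums approximate from below.\<close>

lemma hquo_riemann_sum:
  fixes n :: nat
  assumes t: "t > 0" and a: "a > 0" and n: "n > 0"
  shows "(\<Sum>k<n. hquo (real k / real n) t a) / real n \<le> t * ln (t / a)"
    and "t * ln (t / a) \<le> (\<Sum>k<n. hquo (real k / real n) t a) / real n + (t - a)\<^sup>2 / a / real n"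
proof -
  \<comment> \<open>Nodes on the segment from \<open>t\<close> to \<open>a\<close>. The increments
    of \<open>ln\<close> between neighbours telescope to \<open>ln (t / a)\<close>, and the tangent
    inequality at either endpoint of a step gives the lower or the upper Riemann term.\<close>
  define y where "y k = (1 - real k / real n) * t + real k / real n * a" for k :: nat
  have ypos: "y k > 0" if "k \<le> n" for k
  proof (cases "k = n")
    case False
    then have "1 - real k / real n > 0" using that n by (simp add: field_simps)
    then show ?thesis unfolding y_def using t a by (simp add: add_pos_nonneg)
  qed (use a n in \<open>simp add: y_def\<close>)
  have hy: "hquo (real k / real n) t a = t * (t - a) / y k" if "k \<le> n" for k
  proof -
    have "y k + real k / real n * (t - a) = t"
      by (simp add: y_def algebra_simps add_divide_distrib diff_divide_distrib)
    then have "t * (t - a) / y k = (y k + real k / real n * (t - a)) * (t - a) / y k" by simp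
    also have "\<dots> = (t - a) + real k / real n * ((t - a)\<^sup>2 / y k)"
      using ypos[OF that] by (simp add: add_divide_distrib distrib_right power2_eq_square)
    finally show ?thesis unfolding hquo_def y_def by simp
  qed
  have dy: "y k - y (Suc k) = (t - a) / real n" for k
    by (simp add: y_def algebra_simps add_divide_distrib diff_divide_distrib)
  have tel: "(\<Sum>k<n. ln (y k) - ln (y (Suc k))) = ln (t / a)"
  proof -
    have "(\<Sum>k<n. ln (y k) - ln (y (Suc k))) = ln (y 0) - ln (y n)"
      by (rule sum_lessThan_telescope'[where f = "\<lambda>k. ln (y k)"])
    then show ?thesis using t a n by (simp add: y_def ln_div)
  qed
  have lo: "hquo (real k / real n) t a / real n \<le> t * (ln (y k) - ln (y (Suc k)))" if "k < n" for k
  proof -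
    have "ln (y (Suc k)) - ln (y k) \<le> (y (Suc k) - y k) / y k"
      using ypos that by (intro ln_diff_le) auto
    also have "\<dots> = - ((t - a) / real n / y k)" 
    proof -
      have "y (Suc k) - y k = - ((t - a) / real n)" using dy[of k] by linarith
      then show ?thesis by simp
    qed
    finally have "t * ((t - a) / real n / y k) \<le> t * (ln (y k) - ln (y (Suc k)))"
      using t by (intro mult_left_mono) auto
    then show ?thesis using hy[of k] that by (simp add: mult_ac)
  qed
  have hi: "t * (ln (y k) - ln (y (Suc k))) \<le> hquo (real (Suc k) / real n) t a / real n"
    if "k < n" for k
  proof -
    have "ln (y k) - ln (y (Suc k)) \<le> (y k - y (Suc k)) / y (Suc k)"
      using ypos that by (intro ln_diff_le) auto
    also have "\<dots> = (t - a) / real n / y (Suc k)" using dy[of k] by simp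
    finally have "t * (ln (y k) - ln (y (Suc k))) \<le> t * ((t - a) / real n / y (Suc k))"
      using t by (intro mult_left_mono) auto
    also have "\<dots> = hquo (real (Suc k) / real n) t a / real n"
      using hy[of "Suc k"] that by (simp add: mult_ac del: of_nat_Suc)
    finally show ?thesis .
  qed
  have "(\<Sum>k<n. hquo (real k / real n) t a) / real n \<le> (\<Sum>k<n. t * (ln (y k) - ln (y (Suc k))))"
    unfolding sum_divide_distrib by (intro sum_mono lo) simp
  also have "\<dots> = t * ln (t / a)" by (simp only: sum_distrib_left[symmetric] tel)
  finally show "(\<Sum>k<n. hquo (real k / real n) t a) / real n \<le> t * ln (t / a)" .
  have "t * ln (t / a) = (\<Sum>k<n. t * (ln (y k) - ln (y (Suc k))))"
    by (simp only: sum_distrib_left[symmetric] tel)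
  also have "\<dots> \<le> (\<Sum>k<n. hquo (real (Suc k) / real n) t a) / real n"
    unfolding sum_divide_distrib by (intro sum_mono hi) simp
  \<comment> \<open>Moving from right to left endpoints costs a telescoping sum, the difference of
    \<open>hquo\<close> at \<open>s = 1\<close> and \<open>s = 0\<close>; this is the origin of the
    error term \<open>(t - a)\<^sup>2 / a\<close>.\<close>
  also have "(\<Sum>k<n. hquo (real (Suc k) / real n) t a)
      = (\<Sum>k<n. hquo (real k / real n) t a) + (\<Sum>k<n. hquo (real (Suc k) / real n) t a - hquo (real k / real n) t a)"
    by (simp add: sum_subtractf)
  also have "(\<Sum>k<n. hquo (real (Suc k) / real n) t a - hquo (real k / real n) t a)
      = hquo (real n / real n) t a - hquo (real 0 / real n) t a"
    by (rule sum_lessThan_telescope)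
  also have "\<dots> = (t - a)\<^sup>2 / a" using n by (simp add: hquo_def)
  finally show "t * ln (t / a) \<le> (\<Sum>k<n. hquo (real k / real n) t a) / real n + (t - a)\<^sup>2 / a / real n"
    by (simp add: add_divide_distrib)
qed

section \<open>Linear functionals as minorants\<close>

definition lin :: "nat \<Rightarrow> (cmat \<Rightarrow> real) \<Rightarrow> bool" where
  "lin N F \<longleftrightarrow> (\<exists>P. \<forall>T. F T = Re (\<Sum>r<N. \<Sum>s<N. P r s * T r s))"

lemma lin_add: "lin N F \<Longrightarrow> lin N G \<Longrightarrow> lin N (\<lambda>T. F T + G T)"
proof -
  assume "lin N F" "lin N G"
  then obtain P Q where PQ: "\<forall>T. F T = Re (\<Sum>r<N. \<Sum>s<N. P r s * T r s)"
    "\<forall>T. G T = Re (\<Sum>r<N. \<Sum>s<N. Q r s * T r s)" unfolding lin_def by blast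
  have "F T + G T = Re (\<Sum>r<N. \<Sum>s<N. (P r s + Q r s) * T r s)" for T
    unfolding PQ[rule_format] distrib_right sum.distrib by simp
  then show ?thesis unfolding lin_def by (intro exI allI)
qed

lemma lin_scale: "lin N F \<Longrightarrow> lin N (\<lambda>T. c * F T)"
proof -
  assume "lin N F"
  then obtain P where P: "\<forall>T. F T = Re (\<Sum>r<N. \<Sum>s<N. P r s * T r s)"
    unfolding lin_def by blast
  have "c * F T = Re (\<Sum>r<N. \<Sum>s<N. (complex_of_real c * P r s) * T r s)" for T
    unfolding P[rule_format] by (simp add: sum_distrib_left right_diff_distrib mult_ac)
  then show ?thesis unfolding lin_def by (intro exI allI)
qed

lemma lin_diff: "lin N F \<Longrightarrow> lin N G \<Longrightarrow> lin N (\<lambda>T. F T - G T)"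
  using lin_add[of N F "\<lambda>T. - 1 * G T"] lin_scale[of N G "- 1"] by simp

lemma lin_sum:
  assumes "\<And>i. i \<in> I \<Longrightarrow> lin N (F i)"
  shows "lin N (\<lambda>T. \<Sum>i\<in>I. F i T)"
  using assms
proof (induction I rule: infinite_finite_induct)
  case (insert i I)
  then show ?case by (simp add: lin_add)
qed (auto simp: lin_def intro!: exI[of _ "\<lambda>r s. 0"])

text \<open>The real part of the Hilbert-Schmidt inner product.\<close>

definition hs :: "nat \<Rightarrow> cmat \<Rightarrow> cmat \<Rightarrow> real" where
  "hs N Y Z = Re (\<Sum>r<N. \<Sum>s<N. cnj (Y r s) * Z r s)"

lemma lin_hs: "lin N (hs N Y)"
  unfolding lin_def hs_def by (rule exI[of _ "\<lambda>r s. cnj (Y r s)"]) simp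

lemma lin_hs_left: "lin N (\<lambda>T. hs N Y (mm N T Z))"
proof -
  have "(\<Sum>r<N. \<Sum>s<N. cnj (Y r s) * mm N T Z r s)
      = (\<Sum>r<N. \<Sum>q<N. (\<Sum>s<N. cnj (Y r s) * Z q s) * T r q)" for T
  proof -
    have "(\<Sum>r<N. \<Sum>s<N. cnj (Y r s) * mm N T Z r s)
      = (\<Sum>r<N. \<Sum>s<N. \<Sum>q<N. cnj (Y r s) * Z q s * T r q)"
      by (simp add: mm_def sum_distrib_left mult_ac)
    also have "\<dots> = (\<Sum>r<N. \<Sum>q<N. \<Sum>s<N. cnj (Y r s) * Z q s * T r q)"
      by (intro sum.cong refl sum.swap)
    finally show ?thesis by (simp add: sum_distrib_right)
  qed
  then show ?thesis unfolding lin_def hs_def by (intro exI allI) (rule arg_cong)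
qed

lemma lin_hs_right: "lin N (\<lambda>A. hs N Y (mm N Z A))"
proof -
  have "(\<Sum>r<N. \<Sum>s<N. cnj (Y r s) * mm N Z A r s)
      = (\<Sum>q<N. \<Sum>s<N. (\<Sum>r<N. cnj (Y r s) * Z r q) * A q s)" for A
  proof -
    have "(\<Sum>r<N. \<Sum>s<N. cnj (Y r s) * mm N Z A r s)
      = (\<Sum>r<N. \<Sum>s<N. \<Sum>q<N. cnj (Y r s) * Z r q * A q s)"
      by (simp add: mm_def sum_distrib_left mult_ac)
    also have "\<dots> = (\<Sum>s<N. \<Sum>r<N. \<Sum>q<N. cnj (Y r s) * Z r q * A q s)"
      by (rule sum.swap)
    also have "\<dots> = (\<Sum>s<N. \<Sum>q<N. \<Sum>r<N. cnj (Y r s) * Z r q * A q s)"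
      by (intro sum.cong refl sum.swap)
    also have "\<dots> = (\<Sum>q<N. \<Sum>s<N. \<Sum>r<N. cnj (Y r s) * Z r q * A q s)"
      by (rule sum.swap)
    finally show ?thesis by (simp add: sum_distrib_right)
  qed
  then show ?thesis unfolding lin_def hs_def by (intro exI allI) (rule arg_cong)
qed

definition ident :: cmat where "ident r s = of_bool (r = s)"

lemma bil_ident: "bil N ident x y = ip N x y"
  unfolding bil_ip ident_def ip_def
  by (intro sum.cong refl arg_cong2[where f = "(*)"] sum_of_bool_mult(2)) simp

lemma hs_ident: "hs N ident T = Re (\<Sum>r<N. T r r)"
proof -
  have "cnj (of_bool b) = of_bool b" for b by (cases b) auto
  then show ?thesis
    unfolding hs_def ident_def
    by (intro arg_cong[where f = Re] sum.cong refl) (simp only:, rule sum_of_bool_mult(2), simp)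
qed

lemma hs_eigen:
  assumes "orthonormal N u" "orthonormal N v"
  shows "hs N Y Z = (\<Sum>i<N. \<Sum>j<N. Re (cnj (bil N Y (u i) (v j)) * bil N Z (u i) (v j)))"
  unfolding hs_def bil_parseval[OF assms, of Y Z, symmetric] by simp

lemma bil_sdec_left:
  assumes "sdec N T t u" "i < N"
  shows "bil N T (u i) y = t i * ip N (u i) y"
proof -
  have "bil N T (u i) y = (\<Sum>j<N. t j * (cnj (ip N (u j) (u i)) * ip N (u j) y))"
    by (rule sdec_bil[OF assms(1)])
  also have "\<dots> = (\<Sum>j<N. of_bool (j = i) * (t j * ip N (u j) y))"
    using assms by (intro sum.cong refl) (auto simp: sdec_def orthonormal_def)
  also have "\<dots> = t i * ip N (u i) y"
    by (rule sum_of_bool_mult(1)[OF assms(2)])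
  finally show ?thesis .
qed

lemma bil_sdec_right:
  assumes "sdec N A a v" "j < N"
  shows "bil N A x (v j) = a j * ip N x (v j)"
  unfolding bil_ip using sdec_eigen[OF assms] by (simp add: ip_def sum_distrib_left mult_ac)

text \<open>Completing the square: \<open>D\<close> times the gap is the squared modulus of
  \<open>D * y - d * c\<close>. For fixed \<open>y\<close> and \<open>c\<close> the left side is
  linear in \<open>(d, D)\<close>, so the quotient \<open>d\<^sup>2 / D\<close> is displayed as a
  supremum of linear functions.\<close>

lemma quadratic_sup:
  fixes y c :: complex
  assumes "D > 0"
  shows "2 * (d * Re (cnj y * c)) - D * (cmod y)\<^sup>2 \<le> d\<^sup>2 * (cmod c)\<^sup>2 / D"
    and "y = of_real (d / D) * c \<Longrightarrow>
      2 * (d * Re (cnj y * c)) - D * (cmod y)\<^sup>2 = d\<^sup>2 * (cmod c)\<^sup>2 / D"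
proof -
  have "0 \<le> (cmod (of_real D * y - of_real d * c))\<^sup>2" by simp
  also have "\<dots> = D * (D * (cmod y)\<^sup>2 - 2 * (d * Re (cnj y * c))) + d\<^sup>2 * (cmod c)\<^sup>2"
    unfolding cmod_power2 by (simp add: power2_eq_square algebra_simps)
  finally have "D * (2 * (d * Re (cnj y * c)) - D * (cmod y)\<^sup>2) \<le> d\<^sup>2 * (cmod c)\<^sup>2"
    by (simp add: algebra_simps)
  then show "2 * (d * Re (cnj y * c)) - D * (cmod y)\<^sup>2 \<le> d\<^sup>2 * (cmod c)\<^sup>2 / D"
    using assms by (simp add: pos_le_divide_eq mult.commute)
  assume y: "y = of_real (d / D) * c"
  have 1: "Re (cnj y * c) = d / D * (cmod c)\<^sup>2"
    unfolding y cmod_power2 by (simp add: power2_eq_square algebra_simps add_divide_distrib)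
  have 2: "(cmod y)\<^sup>2 = (d / D)\<^sup>2 * (cmod c)\<^sup>2"
    unfolding y norm_mult norm_of_real power_mult_distrib by (simp add: power_divide)
  show "2 * (d * Re (cnj y * c)) - D * (cmod y)\<^sup>2 = d\<^sup>2 * (cmod c)\<^sup>2 / D"
    unfolding 1 2 using assms by (simp add: field_simps power2_eq_square)
qed

text \<open>The rank-one matrices built from \<open>u k\<close> and the adjoint of
  \<open>v l\<close> form a basis. Hence the scalar maximizers, one per pair of eigenvectors, can be
  assembled into a single matrix.\<close>

lemma matrix_with_coefficients:
  assumes "orthonormal N u" "orthonormal N v"
  shows "\<exists>Y. \<forall>i<N. \<forall>j<N. bil N Y (u i) (v j) = y i j"
proof -
  define Y where "Y r s = (\<Sum>k<N. \<Sum>l<N. y k l * (u k r * cnj (v l s)))" for r s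
  have "bil N Y (u i) (v j) = y i j" if i: "i < N" and j: "j < N" for i j
  proof -
    have "bil N Y (u i) (v j) = (\<Sum>k<N. \<Sum>l<N. y k l * bil N (\<lambda>r s. u k r * cnj (v l s)) (u i) (v j))"
      unfolding Y_def bil_sum bil_scale ..
    also have "\<dots> = (\<Sum>k<N. \<Sum>l<N. y k l * (ip N (u i) (u k) * ip N (v l) (v j)))"
      by (simp add: bil_def ip_def sum_product mult_ac)
    also have "\<dots> = (\<Sum>k<N. of_bool (i = k) * (\<Sum>l<N. y k l * of_bool (l = j)))"
      using assms i j by (simp add: orthonormal_def sum_distrib_left mult_ac del: sum_of_bool_mult_eq sum_mult_of_bool_eq)
    also have "\<dots> = (\<Sum>l<N. y i l * of_bool (l = j))" by (rule sum_of_bool_mult(2)[OF i])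
    also have "\<dots> = y i j" by (rule sum_of_bool_mult(3)[OF j])
    finally show ?thesis .
  qed
  then show ?thesis by blast
qed

text \<open>For fixed \<open>s\<close> the trace functional built from \<open>hquo s\<close> is a supremum over \<open>Y\<close>
  of functionals linear in \<open>(T, A)\<close>, attained; this is joint convexity.\<close>

lemma hquo_linear_minorant:
  assumes T0: "sdec N T0 t0 u0" and A0: "sdec N A0 a0 v0"
    and pos0: "\<And>i. i < N \<Longrightarrow> t0 i > 0 \<and> a0 i > 0"
    and s: "0 \<le> s" "s < 1"
  shows "\<exists>F G. lin N F \<and> lin N G \<and>
    (\<forall>T A t u a v. sdec N T t u \<longrightarrow> sdec N A a v \<longrightarrow> (\<forall>i<N. t i > 0 \<and> a i > 0) \<longrightarrow>
      F T + G A \<le> (\<Sum>i<N. \<Sum>j<N. (cmod (ip N (u i) (v j)))\<^sup>2 * hquo s (t i) (a j))) \<and>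
    F T0 + G A0 = (\<Sum>i<N. \<Sum>j<N. (cmod (ip N (u0 i) (v0 j)))\<^sup>2 * hquo s (t0 i) (a0 j))"
proof -
  \<comment> \<open>In each coefficient this is the maximizer of \<open>quadratic_sup\<close> at the
    base pair, with \<open>d = t0 i - a0 j\<close> and \<open>D = (1 - s) * t0 i + s * a0 j\<close>.
    It stays fixed while \<open>T\<close> and \<open>A\<close> vary.\<close>
  obtain Y where Y: "\<And>i j. i < N \<Longrightarrow> j < N \<Longrightarrow> bil N Y (u0 i) (v0 j)
      = of_real ((t0 i - a0 j) / ((1 - s) * t0 i + s * a0 j)) * ip N (u0 i) (v0 j)"
    using matrix_with_coefficients[OF sdec_orthonormal[OF T0] sdec_orthonormal[OF A0],
        where y = "\<lambda>i j. of_real ((t0 i - a0 j) / ((1 - s) * t0 i + s * a0 j)) * ip N (u0 i) (v0 j)"]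
    by blast
  \<comment> \<open>Together \<open>F T + G A\<close> is the trace of \<open>T - A\<close> plus
    \<open>s\<close> times the concave quadratic in \<open>Y\<close>, twice the pairing with
    \<open>T - A\<close> minus the pairing of \<open>Y\<close> with
    \<open>(1 - s) T Y + s Y A\<close>.\<close>
  define F where "F T = hs N ident T + s * (2 * hs N Y T - (1 - s) * hs N Y (mm N T Y))" for T
  define G where "G A = - 1 * hs N ident A + s * (- 2 * hs N Y A - s * hs N Y (mm N Y A))" for A
  have lF: "lin N F" unfolding F_def
    by (intro lin_add lin_scale lin_diff lin_hs lin_hs_left)
  have lG: "lin N G" unfolding G_def
    by (intro lin_add lin_scale lin_diff lin_hs lin_hs_right)
  have eq: "F T + G A = (\<Sum>i<N. \<Sum>j<N. (cmod (ip N (u i) (v j)))\<^sup>2 * (t i - a j)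
      + s * (2 * ((t i - a j) * Re (cnj (bil N Y (u i) (v j)) * ip N (u i) (v j)))
        - ((1 - s) * t i + s * a j) * (cmod (bil N Y (u i) (v j)))\<^sup>2))"
    if T: "sdec N T t u" and A: "sdec N A a v" for T A t u a v
  proof -
    note e = hs_eigen[OF sdec_orthonormal[OF T] sdec_orthonormal[OF A]]
    have z: "Re (cnj z * z) = (cmod z)\<^sup>2" for z
      unfolding cmod_power2 by (simp add: power2_eq_square)
    have Re_l: "Re (z * (of_real r * w)) = r * Re (z * w)" for z w :: complex and r
      by (simp add: algebra_simps)
    have i1: "hs N ident T = (\<Sum>i<N. \<Sum>j<N. t i * (cmod (ip N (u i) (v j)))\<^sup>2)"
      unfolding e bil_ident by (auto simp: bil_sdec_left[OF T] Re_l z simp del: times_complex.sel intro!: sum.cong)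
    have i2: "hs N ident A = (\<Sum>i<N. \<Sum>j<N. a j * (cmod (ip N (u i) (v j)))\<^sup>2)"
      unfolding e bil_ident by (auto simp: bil_sdec_right[OF A] Re_l z simp del: times_complex.sel intro!: sum.cong)
    have i3: "hs N Y T = (\<Sum>i<N. \<Sum>j<N. t i * Re (cnj (bil N Y (u i) (v j)) * ip N (u i) (v j)))"
      unfolding e by (auto simp: bil_sdec_left[OF T] Re_l simp del: times_complex.sel intro!: sum.cong)
    have i4: "hs N Y A = (\<Sum>i<N. \<Sum>j<N. a j * Re (cnj (bil N Y (u i) (v j)) * ip N (u i) (v j)))"
      unfolding e by (auto simp: bil_sdec_right[OF A] Re_l simp del: times_complex.sel intro!: sum.cong)
    have i5: "hs N Y (mm N T Y) = (\<Sum>i<N. \<Sum>j<N. t i * (cmod (bil N Y (u i) (v j)))\<^sup>2)"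
      unfolding e by (auto simp: bil_mm_left[OF T] Re_l z simp del: times_complex.sel intro!: sum.cong)
    have i6: "hs N Y (mm N Y A) = (\<Sum>i<N. \<Sum>j<N. a j * (cmod (bil N Y (u i) (v j)))\<^sup>2)"
      unfolding e by (auto simp: bil_mm_right[OF A] Re_l z simp del: times_complex.sel intro!: sum.cong)
    show ?thesis
      unfolding F_def G_def i1 i2 i3 i4 i5 i6 sum_distrib_left sum_subtractf[symmetric] sum.distrib[symmetric]
      by (intro sum.cong refl) (simp add: algebra_simps del: times_complex.sel)
  qed
  have hq: "(cmod c)\<^sup>2 * hquo s t a = (cmod c)\<^sup>2 * (t - a) + s * ((t - a)\<^sup>2 * (cmod c)\<^sup>2 / ((1 - s) * t + s * a))"
    for c :: complex and t a by (simp add: hquo_def algebra_simps)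
  have Dpos: "(1 - s) * t + s * a > 0" if "t > 0" "a > 0" for t a
    using that s by (simp add: add_pos_nonneg)
  have "F T + G A \<le> (\<Sum>i<N. \<Sum>j<N. (cmod (ip N (u i) (v j)))\<^sup>2 * hquo s (t i) (a j))"
    if "sdec N T t u" "sdec N A a v" "\<forall>i<N. t i > 0 \<and> a i > 0" for T A t u a v
    unfolding eq[OF that(1,2)] hq using that(3) s
    by (intro sum_mono add_left_mono mult_left_mono quadratic_sup(1) Dpos) auto
  moreover have "F T0 + G A0 = (\<Sum>i<N. \<Sum>j<N. (cmod (ip N (u0 i) (v0 j)))\<^sup>2 * hquo s (t0 i) (a0 j))"
    unfolding eq[OF T0 A0] hq
    by (intro sum.cong refl arg_cong2[where f = "(+)"] arg_cong2[where f = "(*)"] quadratic_sup(2) Dpos)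
      (use pos0 Y in auto)
  ultimately show ?thesis using lF lG by blast
qed

text \<open>The minorants at the nodes \<open>s = k / n\<close> are averaged. Left Riemann sums lie
  below the integral, so the average is still a minorant; at the base pair it falls short by at most
  \<open>C / n\<close>, where \<open>C\<close> collects the quadrature errors of all eigenvalue
  pairs.\<close>

lemma relative_entropy_linear_minorant:
  assumes T0: "sdec N T0 t0 u0" and A0: "sdec N A0 a0 v0"
    and pos0: "\<And>i. i < N \<Longrightarrow> t0 i > 0 \<and> a0 i > 0"
    and eps: "\<epsilon> > 0"
  shows "\<exists>F G. lin N F \<and> lin N G \<and>
    (\<forall>T A t u a v. sdec N T t u \<longrightarrow> sdec N A a v \<longrightarrow> (\<forall>i<N. t i > 0 \<and> a i > 0) \<longrightarrow>
      F T + G A \<le> (\<Sum>i<N. \<Sum>j<N. (cmod (ip N (u i) (v j)))\<^sup>2 * (t i * ln (t i / a j)))) \<and>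
    (\<Sum>i<N. \<Sum>j<N. (cmod (ip N (u0 i) (v0 j)))\<^sup>2 * (t0 i * ln (t0 i / a0 j))) \<le> F T0 + G A0 + \<epsilon>"
proof -
  define C where "C = (\<Sum>i<N. \<Sum>j<N. (cmod (ip N (u0 i) (v0 j)))\<^sup>2 * ((t0 i - a0 j)\<^sup>2 / a0 j))"
  obtain n0 :: nat where n0: "C / \<epsilon> < real n0" using reals_Archimedean2 by blast
  define n where "n = Suc n0"
  have n: "n > 0" "C / \<epsilon> < real n" using n0 by (simp_all add: n_def)
  have Cn: "C / real n \<le> \<epsilon>" using n eps by (simp add: field_simps)
  define minorant where "minorant k F G \<longleftrightarrow> lin N F \<and> lin N G \<and>
    (\<forall>T A t u a v. sdec N T t u \<longrightarrow> sdec N A a v \<longrightarrow> (\<forall>i<N. t i > 0 \<and> a i > 0) \<longrightarrow>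
      F T + G A \<le> (\<Sum>i<N. \<Sum>j<N. (cmod (ip N (u i) (v j)))\<^sup>2 * hquo (real k / real n) (t i) (a j))) \<and>
    F T0 + G A0 = (\<Sum>i<N. \<Sum>j<N. (cmod (ip N (u0 i) (v0 j)))\<^sup>2 * hquo (real k / real n) (t0 i) (a0 j))"
    for k F G
  have "\<forall>k. \<exists>F G. k < n \<longrightarrow> minorant k F G"
  proof
    fix k show "\<exists>F G. k < n \<longrightarrow> minorant k F G"
      using hquo_linear_minorant[OF T0 A0 pos0, of "real k / real n"] n(1)
      unfolding minorant_def by (cases "k < n") auto
  qed
  then obtain F G where mino: "\<And>k. k < n \<Longrightarrow> minorant k (F k) (G k)" by metis
  have FG: "\<And>k. k < n \<Longrightarrow> lin N (F k) \<and> lin N (G k)"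
    "\<And>k T A t u a v. k < n \<Longrightarrow> sdec N T t u \<Longrightarrow> sdec N A a v \<Longrightarrow> (\<forall>i<N. t i > 0 \<and> a i > 0) \<Longrightarrow>
      F k T + G k A \<le> (\<Sum>i<N. \<Sum>j<N. (cmod (ip N (u i) (v j)))\<^sup>2 * hquo (real k / real n) (t i) (a j))"
    "\<And>k. k < n \<Longrightarrow> F k T0 + G k A0 = (\<Sum>i<N. \<Sum>j<N. (cmod (ip N (u0 i) (v0 j)))\<^sup>2 * hquo (real k / real n) (t0 i) (a0 j))"
    using mino unfolding minorant_def by blast+
  define F' where "F' T = (1 / real n) * (\<Sum>k<n. F k T)" for T
  define G' where "G' T = (1 / real n) * (\<Sum>k<n. G k T)" for T
  have lin: "lin N F'" "lin N G'"
    unfolding F'_def G'_def using FG(1) by (intro lin_scale lin_sum; simp)+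
  have swap: "(1 / real n) * (\<Sum>k<n. \<Sum>i<N. \<Sum>j<N. w i j * h k i j) = (\<Sum>i<N. \<Sum>j<N. w i j * ((\<Sum>k<n. h k i j) / real n))"
    for w :: "nat \<Rightarrow> nat \<Rightarrow> real" and h
  proof -
    have "(\<Sum>k<n. \<Sum>i<N. \<Sum>j<N. w i j * h k i j) = (\<Sum>i<N. \<Sum>k<n. \<Sum>j<N. w i j * h k i j)"
      by (rule sum.swap)
    also have "\<dots> = (\<Sum>i<N. \<Sum>j<N. \<Sum>k<n. w i j * h k i j)" by (intro sum.cong refl sum.swap)
    finally show ?thesis by (simp add: sum_distrib_left sum_divide_distrib)
  qed
  have FG': "F' T + G' A = (1 / real n) * (\<Sum>k<n. F k T + G k A)" for T A
    by (simp add: F'_def G'_def sum.distrib distrib_left add_divide_distrib)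
  have "F' T + G' A \<le> (\<Sum>i<N. \<Sum>j<N. (cmod (ip N (u i) (v j)))\<^sup>2 * (t i * ln (t i / a j)))"
    if "sdec N T t u" "sdec N A a v" "\<forall>i<N. t i > 0 \<and> a i > 0" for T A t u a v
  proof -
    have "F' T + G' A \<le> (1 / real n) * (\<Sum>k<n. \<Sum>i<N. \<Sum>j<N. (cmod (ip N (u i) (v j)))\<^sup>2 * hquo (real k / real n) (t i) (a j))"
      unfolding FG' using FG(2) that by (intro mult_left_mono sum_mono) auto
    also have "\<dots> = (\<Sum>i<N. \<Sum>j<N. (cmod (ip N (u i) (v j)))\<^sup>2 * ((\<Sum>k<n. hquo (real k / real n) (t i) (a j)) / real n))"
      by (rule swap)
    also have "\<dots> \<le> (\<Sum>i<N. \<Sum>j<N. (cmod (ip N (u i) (v j)))\<^sup>2 * (t i * ln (t i / a j)))"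
      using that(3) n(1) by (intro sum_mono mult_left_mono hquo_riemann_sum(1)) auto
    finally show ?thesis .
  qed
  moreover have "(\<Sum>i<N. \<Sum>j<N. (cmod (ip N (u0 i) (v0 j)))\<^sup>2 * (t0 i * ln (t0 i / a0 j))) \<le> F' T0 + G' A0 + \<epsilon>"
  proof -
    have "(\<Sum>i<N. \<Sum>j<N. (cmod (ip N (u0 i) (v0 j)))\<^sup>2 * (t0 i * ln (t0 i / a0 j)))
      \<le> (\<Sum>i<N. \<Sum>j<N. (cmod (ip N (u0 i) (v0 j)))\<^sup>2 *
          ((\<Sum>k<n. hquo (real k / real n) (t0 i) (a0 j)) / real n + (t0 i - a0 j)\<^sup>2 / a0 j / real n))"
      using pos0 n(1) by (intro sum_mono mult_left_mono hquo_riemann_sum(2)) auto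
    also have "\<dots> = F' T0 + G' A0 + C / real n"
    proof -
      have "F' T0 + G' A0 = (1 / real n) * (\<Sum>k<n. \<Sum>i<N. \<Sum>j<N.
          (cmod (ip N (u0 i) (v0 j)))\<^sup>2 * hquo (real k / real n) (t0 i) (a0 j))"
        unfolding FG' using FG(3) by simp
      also have "\<dots> = (\<Sum>i<N. \<Sum>j<N. (cmod (ip N (u0 i) (v0 j)))\<^sup>2 *
          ((\<Sum>k<n. hquo (real k / real n) (t0 i) (a0 j)) / real n))"
        by (rule swap)
      finally show ?thesis
        by (simp add: C_def distrib_left sum.distrib sum_divide_distrib)
    qed
    finally show ?thesis using Cn by linarith
  qed
  ultimately show ?thesis using lin by blast
qed

text \<open>Doubly stochastic overlaps reduce this to the scalar bound
  \<open>t * (1 + k - ln t) \<le> exp k\<close>, that is \<open>1 + z \<le> exp z\<close> at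
  \<open>z = k - ln t\<close>.\<close>

lemma gibbs_variational:
  assumes T: "sdec N T t u" and K: "sdec N K k v" and pos: "\<And>i. i < N \<Longrightarrow> t i > 0"
  shows "(\<Sum>i<N. t i) + Re (\<Sum>r<N. \<Sum>s<N. T r s * K s r) - (\<Sum>i<N. t i * ln (t i)) \<le> (\<Sum>j<N. exp (k j))"
proof -
  let ?w = "\<lambda>i j. (cmod (ip N (u i) (v j)))\<^sup>2"
  have row: "(\<Sum>j<N. ?w i j) = 1" if "i < N" for i
  proof -
    have "?w i j = (cmod (ip N (v j) (u i)))\<^sup>2" for j by (metis cnj_ip complex_mod_cnj)
    then show ?thesis
      using orthonormal_parseval_norm[OF sdec_orthonormal[OF K], of "u i"] sdec_norm[OF T that] by simp
  qed
  have col: "(\<Sum>i<N. ?w i j) = 1" if "j < N" for j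
    using orthonormal_parseval_norm[OF sdec_orthonormal[OF T], of "v j"] sdec_norm[OF K that] by simp
  have "(\<Sum>i<N. t i) + Re (\<Sum>r<N. \<Sum>s<N. T r s * K s r) - (\<Sum>i<N. t i * ln (t i))
      = (\<Sum>i<N. (t i - t i * ln (t i)) * (\<Sum>j<N. ?w i j)) + (\<Sum>i<N. \<Sum>j<N. t i * k j * ?w i j)"
    unfolding sdec_trace_mult_sdec[OF T K] using row by (simp add: sum_subtractf)
  also have "\<dots> = (\<Sum>i<N. \<Sum>j<N. (t i * (1 + (k j - ln (t i)))) * ?w i j)"
    unfolding sum_distrib_left sum.distrib[symmetric] by (intro sum.cong refl) (simp add: algebra_simps)
  also have "\<dots> \<le> (\<Sum>i<N. \<Sum>j<N. exp (k j) * ?w i j)"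
  proof (intro sum_mono mult_right_mono)
    fix i j assume "i \<in> {..<N}"
    then have t: "t i > 0" using pos by simp
    have "t i * (1 + (k j - ln (t i))) \<le> t i * exp (k j - ln (t i))"
      using t by (intro mult_left_mono exp_ge_add_one_self) auto
    also have "\<dots> = exp (k j)" using t by (simp add: exp_diff)
    finally show "t i * (1 + (k j - ln (t i))) \<le> exp (k j)" .
  qed simp
  also have "\<dots> = (\<Sum>j<N. \<Sum>i<N. exp (k j) * ?w i j)" by (rule sum.swap)
  also have "\<dots> = (\<Sum>j<N. exp (k j))" using col by (simp flip: sum_distrib_left)
  finally show ?thesis .
qed

section \<open>Lieb's theorem in expectation\<close>

lemma mfun_mult:
  assumes A: "herm N A"
  shows "mfun N (\<lambda>x. f x * g x) A r s = mm N (mfun N f A) (mfun N g A) r s"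
proof -
  let ?u = "eigu N A" and ?l = "eigv N A"
  have on: "ip N (?u i) (?u j) = of_bool (i = j)" if "i < N" "j < N" for i j
    using sdec_orthonormal[OF sdec_eig[OF A]] that by (simp add: orthonormal_def)
  have "mm N (mfun N f A) (mfun N g A) r s
      = (\<Sum>q<N. \<Sum>i<N. \<Sum>j<N. f (?l i) * ?u i r * (g (?l j) * cnj (?u j s)) * (cnj (?u i q) * ?u j q))"
    unfolding mm_def mfun_def sum_product by (simp add: mult_ac)
  also have "\<dots> = (\<Sum>i<N. \<Sum>q<N. \<Sum>j<N. f (?l i) * ?u i r * (g (?l j) * cnj (?u j s)) * (cnj (?u i q) * ?u j q))"
    by (rule sum.swap)
  also have "\<dots> = (\<Sum>i<N. \<Sum>j<N. \<Sum>q<N. f (?l i) * ?u i r * (g (?l j) * cnj (?u j s)) * (cnj (?u i q) * ?u j q))"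
    by (intro sum.cong refl sum.swap)
  also have "\<dots> = (\<Sum>i<N. \<Sum>j<N. f (?l i) * ?u i r * (g (?l j) * cnj (?u j s)) * of_bool (i = j))"
    unfolding sum_distrib_left[symmetric] ip_def[symmetric] using on by (intro sum.cong refl) simp
  also have "\<dots> = (\<Sum>i<N. f (?l i) * ?u i r * (g (?l i) * cnj (?u i s)))"
    by (intro sum.cong refl sum_of_bool_mult(4)) simp
  finally show ?thesis by (simp add: mfun_def mult_ac)
qed

lemma mfun_diff_le:
  assumes A: "herm N A" and e: "\<And>i. i < N \<Longrightarrow> \<bar>f (eigv N A i) - g (eigv N A i)\<bar> \<le> e"
    and rs: "r < N" "s < N"
  shows "cmod (mfun N f A r s - mfun N g A r s) \<le> real N * e"
proof -
  let ?u = "eigu N A" and ?l = "eigv N A"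
  note on = orthonormal_entry_le[OF sdec_orthonormal[OF sdec_eig[OF A]]]
  have "mfun N f A r s - mfun N g A r s
      = (\<Sum>i<N. complex_of_real (f (?l i) - g (?l i)) * (?u i r * cnj (?u i s)))"
    by (simp add: mfun_def algebra_simps sum_subtractf)
  also have "cmod \<dots> \<le> (\<Sum>i<N. e)"
  proof (intro sum_norm_le)
    fix i assume i: "i \<in> {..<N}"
    have "cmod (?u i r) * cmod (?u i s) \<le> 1 * 1"
      using on rs i by (intro mult_mono) auto
    then have "\<bar>f (?l i) - g (?l i)\<bar> * (cmod (?u i r) * cmod (?u i s)) \<le> e * 1"
      using e[of i] i by (intro mult_mono) auto
    then show "cmod (complex_of_real (f (?l i) - g (?l i)) * (?u i r * cnj (?u i s))) \<le> e"
      unfolding norm_mult norm_of_real complex_mod_cnj by simp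
  qed
  finally show ?thesis by simp
qed

lemma mfun_bound:
  assumes "herm N A" "\<And>i. i < N \<Longrightarrow> \<bar>f (eigv N A i)\<bar> \<le> e" "r < N" "s < N"
  shows "cmod (mfun N f A r s) \<le> real N * e"
proof -
  have "mfun N (\<lambda>x. 0) A r s = 0" by (simp add: mfun_def)
  then show ?thesis using mfun_diff_le[of N A f "\<lambda>x. 0" e r s] assms by simp
qed

text \<open>Crude, but it confines the spectrum to an interval read off from the entries alone,
  which both polynomial approximation and integrability rely on.\<close>

lemma eigv_bound:
  assumes A: "herm N A" and i: "i < N"
  shows "\<bar>eigv N A i\<bar> \<le> (\<Sum>r<N. \<Sum>s<N. cmod (A r s))"
proof -
  let ?x = "eigu N A i"
  note on = orthonormal_entry_le[OF sdec_orthonormal[OF sdec_eig[OF A]] i]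
  have "\<bar>eigv N A i\<bar> = \<bar>qf N A ?x\<bar>" using sdec_qf_eigenvector[OF sdec_eig[OF A] i] by simp
  also have "\<dots> \<le> cmod (bil N A ?x ?x)" unfolding qf_def by (rule abs_Re_le_cmod)
  also have "\<dots> \<le> (\<Sum>r<N. \<Sum>s<N. cmod (A r s))"
    unfolding bil_def
  proof (intro sum_norm_le)
    fix r s assume rs: "r \<in> {..<N}" "s \<in> {..<N}"
    have "cmod (?x r) * cmod (A r s) * cmod (?x s) \<le> 1 * cmod (A r s) * 1"
      using on rs by (intro mult_mono) auto
    then show "cmod (cnj (?x r) * A r s * ?x s) \<le> cmod (A r s)" by (simp add: norm_mult)
  qed
  finally show ?thesis .
qed

text \<open>The functional calculus respects sums and products, so each entry is a polynomial in the
  entries of \<open>A \<omega>\<close> and the arbitrary choice of eigenvectors drops out.\<close>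

lemma measurable_mfun_polynomial:
  fixes q :: "real \<Rightarrow> real"
  assumes q: "real_polynomial_function q"
    and herm: "\<And>\<omega>. \<omega> \<in> space M \<Longrightarrow> herm N (A \<omega>)"
    and meas: "\<And>r s. r < N \<Longrightarrow> s < N \<Longrightarrow> (\<lambda>\<omega>. A \<omega> r s) \<in> borel_measurable M"
  shows "r < N \<Longrightarrow> s < N \<Longrightarrow> (\<lambda>\<omega>. mfun N q (A \<omega>) r s) \<in> borel_measurable M"
  using q
proof (induction q arbitrary: r s rule: real_polynomial_function.induct)
  case (linear f)
  have "f x = x * f 1" for x using linear_scale[OF bounded_linear.linear[OF linear(1)], of x 1] by simp
  then have f: "f = (\<lambda>x. f 1 * x)" by (metis mult.commute)
  have "mfun N f (A \<omega>) r s = complex_of_real (f 1) * A \<omega> r s" if "\<omega> \<in> space M" for \<omega>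
  proof -
    have "mfun N f (A \<omega>) r s = (\<Sum>i<N. complex_of_real (f 1 * eigv N (A \<omega>) i)
        * eigu N (A \<omega>) i r * cnj (eigu N (A \<omega>) i s))"
      unfolding mfun_def by (subst f) (rule refl)
    also have "\<dots> = complex_of_real (f 1) * A \<omega> r s"
      using sdec_eig[OF herm[OF that]] linear(2,3) by (simp add: sdec_def sum_distrib_left mult_ac)
    finally show ?thesis .
  qed
  then show ?case using meas[OF linear(2,3)]
    by (subst measurable_cong[where g = "\<lambda>\<omega>. complex_of_real (f 1) * A \<omega> r s"]) auto
next
  case (const c)
  have "mfun N (\<lambda>x. c) (A \<omega>) r s = complex_of_real c * of_bool (r = s)" if "\<omega> \<in> space M" for \<omega>
    using orthonormal_complete[OF sdec_orthonormal[OF sdec_eig[OF herm[OF that]]] const]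
    unfolding mfun_def by (simp add: mult.assoc flip: sum_distrib_left)
  then show ?case by (subst measurable_cong) auto
next
  case (add f g)
  have "mfun N (\<lambda>x. f x + g x) (A \<omega>) r s = mfun N f (A \<omega>) r s + mfun N g (A \<omega>) r s" for \<omega>
    by (simp add: mfun_def algebra_simps sum.distrib)
  then show ?case using add by simp
next
  case (mult f g)
  have "mfun N (\<lambda>x. f x * g x) (A \<omega>) r s = (\<Sum>q<N. mfun N f (A \<omega>) r q * mfun N g (A \<omega>) q s)"
    if "\<omega> \<in> space M" for \<omega>
    using mfun_mult[OF herm[OF that]] by (simp add: mm_def)
  then show ?case using mult
    by (subst measurable_cong) (auto intro!: borel_measurable_sum borel_measurable_times)
qed

text \<open>Weierstrass approximation on the growing intervals \<open>[-k, k]\<close> with error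
  \<open>1 / (k + 1)\<close>. For each fixed \<omega> the spectrum lies in all but finitely many of
  them, so the entries converge pointwise.\<close>

lemma measurable_mfun:
  fixes f :: "real \<Rightarrow> real"
  assumes f: "continuous_on UNIV f"
    and herm: "\<And>\<omega>. \<omega> \<in> space M \<Longrightarrow> herm N (A \<omega>)"
    and meas: "\<And>r s. r < N \<Longrightarrow> s < N \<Longrightarrow> (\<lambda>\<omega>. A \<omega> r s) \<in> borel_measurable M"
    and rs: "r < N" "s < N"
  shows "(\<lambda>\<omega>. mfun N f (A \<omega>) r s) \<in> borel_measurable M"
proof -
  have "\<forall>k::nat. \<exists>q. real_polynomial_function q \<and> (\<forall>x\<in>{- real k..real k}. \<bar>f x - q x\<bar> < 1 / real (Suc k))"
  proof
    fix k :: nat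
    have "continuous_on {- real k..real k} f" using f continuous_on_subset by blast
    from Stone_Weierstrass_real_polynomial_function[OF compact_Icc this, of "1 / real (Suc k)"]
    show "\<exists>q. real_polynomial_function q \<and> (\<forall>x\<in>{- real k..real k}. \<bar>f x - q x\<bar> < 1 / real (Suc k))"
      by (metis of_nat_0_less_iff zero_less_Suc zero_less_divide_1_iff)
  qed
  then obtain q where q: "\<And>k. real_polynomial_function (q k)"
    "\<And>k x. x \<in> {- real k..real k} \<Longrightarrow> \<bar>f x - q k x\<bar> < 1 / real (Suc k)" by metis
  show ?thesis
  proof (rule borel_measurable_LIMSEQ_metric)
    show "(\<lambda>\<omega>. mfun N (q k) (A \<omega>) r s) \<in> borel_measurable M" for k
      by (rule measurable_mfun_polynomial[OF q(1) herm meas rs])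
    fix \<omega> assume \<omega>: "\<omega> \<in> space M"
    define b where "b = (\<Sum>r<N. \<Sum>s<N. cmod (A \<omega> r s))"
    obtain K :: nat where K: "b \<le> real K" using real_arch_simple by blast
    have "norm (mfun N (q k) (A \<omega>) r s - mfun N f (A \<omega>) r s) \<le> real N * (1 / real (Suc k))"
      if "K \<le> k" for k
    proof (rule mfun_diff_le[OF herm[OF \<omega>] _ rs])
      fix i assume "i < N"
      from eigv_bound[OF herm[OF \<omega>] this] have "\<bar>eigv N (A \<omega>) i\<bar> \<le> real k"
        using K that unfolding b_def by linarith
      then have "eigv N (A \<omega>) i \<in> {- real k..real k}" by auto
      from q(2)[OF this] show "\<bar>q k (eigv N (A \<omega>) i) - f (eigv N (A \<omega>) i)\<bar> \<le> 1 / real (Suc k)"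
        by linarith
    qed
    then have ev: "\<forall>\<^sub>F k in sequentially.
        norm (mfun N (q k) (A \<omega>) r s - mfun N f (A \<omega>) r s) \<le> real N * (1 / real (Suc k))"
      using eventually_sequentially by blast
    have "(\<lambda>k. real N * (1 / real (Suc k))) \<longlonglongrightarrow> 0"
      using tendsto_mult_right_zero[OF LIMSEQ_inverse_real_of_nat] by (simp add: inverse_eq_divide)
    from Lim_null_comparison[OF ev this] show "(\<lambda>k. mfun N (q k) (A \<omega>) r s) \<longlonglongrightarrow> mfun N f (A \<omega>) r s"
      by (simp add: LIM_zero_iff)
  qed
qed

lemma trexp_trace:
  assumes "herm N K"
  shows "(\<Sum>r<N. mfun N exp K r r) = complex_of_real (trexp N K)"
  unfolding trexp_def by (rule sdec_trace[OF sdec_mfun[OF assms]])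

lemma measurable_trexp:
  assumes herm: "\<And>\<omega>. \<omega> \<in> space M \<Longrightarrow> herm N (A \<omega>)"
    and meas: "\<And>r s. r < N \<Longrightarrow> s < N \<Longrightarrow> (\<lambda>\<omega>. A \<omega> r s) \<in> borel_measurable M"
  shows "(\<lambda>\<omega>. trexp N (A \<omega>)) \<in> borel_measurable M"
proof -
  have "trexp N (A \<omega>) = Re (\<Sum>r<N. mfun N exp (A \<omega>) r r)" if "\<omega> \<in> space M" for \<omega>
    using trexp_trace[OF herm[OF that]] by simp
  moreover have "(\<lambda>\<omega>. mfun N exp (A \<omega>) r r) \<in> borel_measurable M" if "r < N" for r
    by (rule measurable_mfun[OF _ herm meas that that]) (auto intro: continuous_intros)
  then have "(\<lambda>\<omega>. Re (\<Sum>r<N. mfun N exp (A \<omega>) r r)) \<in> borel_measurable M"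
    by measurable
  ultimately show ?thesis by (subst measurable_cong) auto
qed

lemma trexp_nonneg: "0 \<le> trexp N K"
  unfolding trexp_def by (intro sum_nonneg) auto

section \<open>Expectations of matrices and Lieb's inequality\<close>

lemma lin_integral:
  assumes "lin N F" and int: "\<And>r s. r < N \<Longrightarrow> s < N \<Longrightarrow> integrable M (\<lambda>\<omega>. T \<omega> r s)"
  shows "integrable M (\<lambda>\<omega>. F (T \<omega>))" "(\<integral>\<omega>. F (T \<omega>) \<partial>M) = F (\<lambda>r s. \<integral>\<omega>. T \<omega> r s \<partial>M)"
proof -
  obtain P where P: "\<forall>T. F T = Re (\<Sum>r<N. \<Sum>s<N. P r s * T r s)"
    using assms(1) unfolding lin_def by blast
  have i: "integrable M (\<lambda>\<omega>. \<Sum>r<N. \<Sum>s<N. P r s * T \<omega> r s)"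
    using int by (intro Bochner_Integration.integrable_sum integrable_mult_right) auto
  then show "integrable M (\<lambda>\<omega>. F (T \<omega>))"
    unfolding P[rule_format] by (rule integrable_Re)
  have "(\<integral>\<omega>. F (T \<omega>) \<partial>M) = Re (\<integral>\<omega>. (\<Sum>r<N. \<Sum>s<N. P r s * T \<omega> r s) \<partial>M)"
    unfolding P[rule_format] by (rule integral_Re[OF i])
  also have "(\<integral>\<omega>. (\<Sum>r<N. \<Sum>s<N. P r s * T \<omega> r s) \<partial>M) = (\<Sum>r<N. \<integral>\<omega>. (\<Sum>s<N. P r s * T \<omega> r s) \<partial>M)"
    using int by (intro Bochner_Integration.integral_sum Bochner_Integration.integrable_sum integrable_mult_right) auto
  also have "\<dots> = (\<Sum>r<N. \<Sum>s<N. \<integral>\<omega>. P r s * T \<omega> r s \<partial>M)"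
    using int by (intro sum.cong refl Bochner_Integration.integral_sum integrable_mult_right) auto
  finally show "(\<integral>\<omega>. F (T \<omega>) \<partial>M) = F (\<lambda>r s. \<integral>\<omega>. T \<omega> r s \<partial>M)"
    unfolding P[rule_format] by simp
qed

lemma lin_cong:
  assumes "lin N F" "\<And>r s. r < N \<Longrightarrow> s < N \<Longrightarrow> A r s = B r s"
  shows "F A = F B"
proof -
  obtain P where "\<forall>T. F T = Re (\<Sum>r<N. \<Sum>s<N. P r s * T r s)"
    using assms(1) unfolding lin_def by blast
  then show ?thesis using assms(2) by simp
qed

lemma lin_qf: "lin N (\<lambda>A. qf N A x)"
  unfolding lin_def qf_def bil_def by (rule exI[of _ "\<lambda>r s. cnj (x r) * x s"]) (simp add: mult_ac)

lemma lin_trace_mult: "lin N (\<lambda>T. Re (\<Sum>r<N. \<Sum>s<N. T r s * H s r))"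
  unfolding lin_def by (rule exI[of _ "\<lambda>r s. H s r"]) (simp add: mult.commute)

lemma herm_integral:
  assumes "\<And>\<omega>. \<omega> \<in> space M \<Longrightarrow> herm N (T \<omega>)"
  shows "herm N (\<lambda>r s. \<integral>\<omega>. T \<omega> r s \<partial>M)"
  unfolding herm_def
proof (intro allI impI)
  fix r s assume rs: "r < N" "s < N"
  have "(\<integral>\<omega>. T \<omega> r s \<partial>M) = (\<integral>\<omega>. cnj (T \<omega> s r) \<partial>M)"
  proof (rule Bochner_Integration.integral_cong[OF refl])
    fix \<omega> assume "\<omega> \<in> space M"
    then show "T \<omega> r s = cnj (T \<omega> s r)" using assms[of \<omega>] rs unfolding herm_def by blast
  qed
  then show "(\<integral>\<omega>. T \<omega> r s \<partial>M) = cnj (\<integral>\<omega>. T \<omega> s r \<partial>M)" by simp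
qed

text \<open>Tropp's form of Lieb's theorem: the Gibbs variational principle writes \<open>tr exp (H + log A)\<close>
  as a maximum over \<open>T\<close> of a jointly concave function of \<open>(T, A)\<close>, so it is concave in \<open>A\<close>.
  Here \<open>A = 1 + g X\<close> and \<open>log A = l X\<close>.\<close>

lemma lieb_expectation:
  fixes X :: "'s \<Rightarrow> cmat" and l :: "real \<Rightarrow> real"
  assumes M: "prob_space M" and H: "herm N H"
    and X: "\<And>\<omega>. \<omega> \<in> space M \<Longrightarrow> herm N (X \<omega>)"
    and int: "\<And>r s. r < N \<Longrightarrow> s < N \<Longrightarrow> integrable M (\<lambda>\<omega>. X \<omega> r s)"
    and l: "continuous_on UNIV l" and C: "\<And>x. \<bar>l x\<bar> \<le> C"
    and ae: "AE \<omega> in M. \<forall>i<N. exp (l (eigv N (X \<omega>) i)) = 1 + g * eigv N (X \<omega>) i"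
    and Xm: "Xm = (\<lambda>r s. \<integral>\<omega>. X \<omega> r s \<partial>M)"
    and eb: "\<And>i. i < N \<Longrightarrow> exp (l (eigv N Xm i)) = 1 + g * eigv N Xm i"
  shows "integrable M (\<lambda>\<omega>. trexp N (\<lambda>r s. H r s + mfun N l (X \<omega>) r s))"
    and "(\<integral>\<omega>. trexp N (\<lambda>r s. H r s + mfun N l (X \<omega>) r s) \<partial>M)
      \<le> trexp N (\<lambda>r s. H r s + mfun N l Xm r s)"
proof -
  interpret prob_space M by (rule M)
  define K where "K \<omega> r s = H r s + mfun N l (X \<omega>) r s" for \<omega> r s
  define T where "T \<omega> = mfun N exp (K \<omega>)" for \<omega>
  define Tm where "Tm r s = (\<integral>\<omega>. T \<omega> r s \<partial>M)" for r s
  define A where "A \<omega> r s = of_bool (r = s) + complex_of_real g * X \<omega> r s" for \<omega> r s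
  define Am where "Am r s = of_bool (r = s) + complex_of_real g * Xm r s" for r s
  have hK: "herm N (K \<omega>)" if "\<omega> \<in> space M" for \<omega>
    unfolding K_def by (intro herm_add H herm_mfun X that)
  have hT: "herm N (T \<omega>)" if "\<omega> \<in> space M" for \<omega>
    unfolding T_def by (intro herm_mfun hK that)
  have hXm: "herm N Xm" unfolding Xm by (rule herm_integral[OF X])
  have mL: "(\<lambda>\<omega>. mfun N l (X \<omega>) r s) \<in> borel_measurable M" if "r < N" "s < N" for r s
    by (rule measurable_mfun[OF l X _ that]) (use int in auto)
  have mK: "(\<lambda>\<omega>. K \<omega> r s) \<in> borel_measurable M" if "r < N" "s < N" for r s
    unfolding K_def using mL[OF that] by simp
  have mT: "(\<lambda>\<omega>. T \<omega> r s) \<in> borel_measurable M" if "r < N" "s < N" for r s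
    unfolding T_def by (rule measurable_mfun[OF _ hK mK that]) (auto intro: continuous_intros)
  \<comment> \<open>The bound \<open>C\<close> on \<open>l\<close> makes the entries of
    \<open>K \<omega>\<close>, hence its spectrum and the entries of its exponential, bounded
    uniformly in \<omega>. All integrability follows from this.\<close>
  define b where "b = (\<Sum>r<N. \<Sum>s<N. cmod (H r s) + real N * C)"
  have Tb: "cmod (T \<omega> r s) \<le> real N * exp b" if \<omega>: "\<omega> \<in> space M" and rs: "r < N" "s < N" for \<omega> r s
    unfolding T_def
  proof (rule mfun_bound[OF hK[OF \<omega>] _ rs])
    fix i assume "i < N"
    then have "\<bar>eigv N (K \<omega>) i\<bar> \<le> (\<Sum>r<N. \<Sum>s<N. cmod (K \<omega> r s))" by (rule eigv_bound[OF hK[OF \<omega>]])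
    also have "\<dots> \<le> b" unfolding b_def K_def
      using mfun_bound[OF X[OF \<omega>], where f = l and e = C] C
      by (intro sum_mono order.trans[OF norm_triangle_ineq] add_left_mono) auto
    finally show "\<bar>exp (eigv N (K \<omega>) i)\<bar> \<le> exp b" by simp
  qed
  have iT: "integrable M (\<lambda>\<omega>. T \<omega> r s)" if "r < N" "s < N" for r s
    by (rule integrable_const_bound[where B = "real N * exp b"]) (use Tb mT that in auto)
  have tr_eq: "trexp N (K \<omega>) = hs N ident (T \<omega>)" if "\<omega> \<in> space M" for \<omega>
    unfolding hs_ident T_def using trexp_trace[OF hK[OF that]] by simp
  have itr: "integrable M (\<lambda>\<omega>. trexp N (K \<omega>))"
    using lin_integral(1)[OF lin_hs[of N ident] iT]
    by (rule Bochner_Integration.integrable_cong[THEN iffD1, rotated -1]) (simp_all add: tr_eq)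
  then show "integrable M (\<lambda>\<omega>. trexp N (\<lambda>r s. H r s + mfun N l (X \<omega>) r s))"
    unfolding K_def .
  have hTm: "herm N Tm" unfolding Tm_def by (rule herm_integral[OF hT])
  obtain t u where Tm: "sdec N Tm t u" using spectral_decomposition[OF hTm] by blast
  \<comment> \<open>Each \<open>T \<omega>\<close> is positive definite, and strict positivity of a
    quadratic form survives integration against a measure of mass 1. The entropy of the mean thus
    involves logarithms of positive numbers only.\<close>
  have tpos: "t i > 0" if i: "i < N" for i
  proof -
    have "0 < qf N (T \<omega>) (u i)" if \<omega>: "\<omega> \<in> space M" for \<omega>
    proof -
      have eq: "qf N (T \<omega>) (u i) = (\<Sum>j<N. exp (eigv N (K \<omega>) j) * (cmod (ip N (eigu N (K \<omega>) j) (u i)))\<^sup>2)"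
        unfolding T_def by (rule sdec_qf[OF sdec_mfun[OF hK[OF \<omega>]]])
      have "qf N (T \<omega>) (u i) \<noteq> 0"
      proof
        assume "qf N (T \<omega>) (u i) = 0"
        then have "\<forall>j<N. (cmod (ip N (eigu N (K \<omega>) j) (u i)))\<^sup>2 = 0"
          unfolding eq by (subst (asm) sum_nonneg_eq_0_iff) auto
        then have "(\<Sum>j<N. (cmod (ip N (eigu N (K \<omega>) j) (u i)))\<^sup>2) = 0" by simp
        then show False
          using orthonormal_parseval_norm[OF sdec_orthonormal[OF sdec_eig[OF hK[OF \<omega>]]], of "u i"]
            sdec_norm[OF Tm i] by simp
      qed
      moreover have "0 \<le> qf N (T \<omega>) (u i)" unfolding eq by (intro sum_nonneg) auto
      ultimately show ?thesis by simp
    qed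
    then have "(\<integral>\<omega>. 0 \<partial>M) < (\<integral>\<omega>. qf N (T \<omega>) (u i) \<partial>M)"
      by (intro integral_less_AE_space lin_integral(1)[OF lin_qf iT]) (auto simp: emeasure_space_1)
    also have "(\<integral>\<omega>. qf N (T \<omega>) (u i) \<partial>M) = qf N Tm (u i)"
      unfolding Tm_def by (rule lin_integral(2)[OF lin_qf iT])
    also have "\<dots> = t i" by (rule sdec_qf_eigenvector[OF Tm i])
    finally show ?thesis by simp
  qed
  have Am: "sdec N Am (\<lambda>i. 1 + g * eigv N Xm i) (eigu N Xm)"
    by (rule sdec_affine[OF sdec_eig[OF hXm]]) (simp add: Am_def)
  have apos: "1 + g * eigv N Xm i > 0" if "i < N" for i
    unfolding eb[OF that, symmetric] by simp
  have iA: "integrable M (\<lambda>\<omega>. A \<omega> r s)" if "r < N" "s < N" for r s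
    unfolding A_def using int[OF that] by simp
  have EA: "(\<integral>\<omega>. A \<omega> r s \<partial>M) = Am r s" if "r < N" "s < N" for r s
    unfolding A_def Am_def Xm using int[OF that] by (simp add: prob_space)
  \<comment> \<open>The minorant is chosen nearly tight at the pair of means
    \<open>(Tm, Am)\<close>. Its linearity allows integration, and tightness then restores the
    relative entropy up to \<epsilon>.\<close>
  have "(\<integral>\<omega>. trexp N (K \<omega>) \<partial>M) \<le> trexp N (\<lambda>r s. H r s + mfun N l Xm r s) + \<epsilon>" if eps: "\<epsilon> > 0" for \<epsilon>
  proof -
    obtain F G where F: "lin N F" and G: "lin N G"
      and min: "\<And>T A t u a v. sdec N T t u \<Longrightarrow> sdec N A a v \<Longrightarrow> (\<forall>i<N. t i > 0 \<and> a i > 0) \<Longrightarrow>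
        F T + G A \<le> (\<Sum>i<N. \<Sum>j<N. (cmod (ip N (u i) (v j)))\<^sup>2 * (t i * ln (t i / a j)))"
      and tight: "(\<Sum>i<N. \<Sum>j<N. (cmod (ip N (u i) (eigu N Xm j)))\<^sup>2 *
          (t i * ln (t i / (1 + g * eigv N Xm j)))) \<le> F Tm + G Am + \<epsilon>"
      using relative_entropy_linear_minorant[OF Tm Am _ eps] tpos apos by blast
    \<comment> \<open>Since \<open>l\<close> is the logarithm of \<open>1 + g x\<close> on the
      spectrum of \<open>Y\<close>, relative entropy separates into a trace in \<open>T\<close>
      alone and the trace of \<open>T\<close> against \<open>mfun N l Y\<close>.\<close>
    have entropy: "(\<Sum>i<N. \<Sum>j<N. (cmod (ip N (u i) (eigu N Y j)))\<^sup>2 * (t i * ln (t i / (1 + g * eigv N Y j))))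
      = (\<Sum>i<N. t i * ln (t i)) - Re (\<Sum>r<N. \<Sum>s<N. T r s * mfun N l Y s r)"
      if T: "sdec N T t u" and tp: "\<And>i. i < N \<Longrightarrow> t i > 0" and Y: "herm N Y"
        and l: "\<And>i. i < N \<Longrightarrow> exp (l (eigv N Y i)) = 1 + g * eigv N Y i" for T t u Y
    proof -
      let ?w = "\<lambda>i j. (cmod (ip N (u i) (eigu N Y j)))\<^sup>2"
      have row: "(\<Sum>j<N. ?w i j) = 1" if "i < N" for i
      proof -
        have "?w i j = (cmod (ip N (eigu N Y j) (u i)))\<^sup>2" for j by (metis cnj_ip complex_mod_cnj)
        then show ?thesis
          using orthonormal_parseval_norm[OF sdec_orthonormal[OF sdec_eig[OF Y]], of "u i"]
            sdec_norm[OF T that] by simp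
      qed
      have ln: "ln (t i / (1 + g * eigv N Y j)) = ln (t i) - l (eigv N Y j)" if "i < N" "j < N" for i j
        using tp[OF that(1)] l[OF that(2)] by (metis exp_gt_zero ln_div ln_exp order_less_irrefl)
      have "(\<Sum>i<N. \<Sum>j<N. ?w i j * (t i * ln (t i / (1 + g * eigv N Y j))))
        = (\<Sum>i<N. \<Sum>j<N. t i * ln (t i) * ?w i j - t i * l (eigv N Y j) * ?w i j)"
        by (intro sum.cong refl) (simp add: ln, simp add: algebra_simps)
      also have "\<dots> = (\<Sum>i<N. t i * ln (t i) * (\<Sum>j<N. ?w i j)) - (\<Sum>i<N. \<Sum>j<N. t i * l (eigv N Y j) * ?w i j)"
        by (simp add: sum_subtractf sum_distrib_left)
      also have "\<dots> = (\<Sum>i<N. t i * ln (t i)) - (\<Sum>i<N. \<Sum>j<N. t i * l (eigv N Y j) * ?w i j)"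
        using row by simp
      also have "(\<Sum>i<N. \<Sum>j<N. t i * l (eigv N Y j) * ?w i j) = Re (\<Sum>r<N. \<Sum>s<N. T r s * mfun N l Y s r)"
        by (rule sdec_trace_mult_sdec[OF T sdec_mfun[OF Y], symmetric])
      finally show ?thesis .
    qed
    define \<Phi> where "\<Phi> T = hs N ident T + Re (\<Sum>r<N. \<Sum>s<N. T r s * H s r) - F T" for T
    have l\<Phi>: "lin N \<Phi>" unfolding \<Phi>_def by (intro lin_diff lin_add lin_hs lin_trace_mult F)
    \<comment> \<open>The equality case of the Gibbs principle: \<open>T \<omega>\<close> is the
      exponential of \<open>K \<omega>\<close>, so its logarithm is
      \<open>H + mfun N l (X \<omega>)\<close> and the second term cancels against the one in the
      relative entropy.\<close>
    have pw: "trexp N (K \<omega>) \<le> \<Phi> (T \<omega>) - G (A \<omega>)"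
      if \<omega>: "\<omega> \<in> space M" and e: "\<forall>i<N. exp (l (eigv N (X \<omega>) i)) = 1 + g * eigv N (X \<omega>) i" for \<omega>
    proof -
      let ?\<kappa> = "eigv N (K \<omega>)"
      have sT: "sdec N (T \<omega>) (\<lambda>i. exp (?\<kappa> i)) (eigu N (K \<omega>))"
        unfolding T_def by (rule sdec_mfun[OF hK[OF \<omega>]])
      have sA: "sdec N (A \<omega>) (\<lambda>i. 1 + g * eigv N (X \<omega>) i) (eigu N (X \<omega>))"
        by (rule sdec_affine[OF sdec_eig[OF X[OF \<omega>]]]) (simp add: A_def)
      have "\<forall>i<N. 0 < exp (?\<kappa> i) \<and> 0 < 1 + g * eigv N (X \<omega>) i" using e by (metis exp_gt_zero)
      from min[OF sT sA this] have "F (T \<omega>) + G (A \<omega>)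
          \<le> (\<Sum>i<N. exp (?\<kappa> i) * ?\<kappa> i) - Re (\<Sum>r<N. \<Sum>s<N. T \<omega> r s * mfun N l (X \<omega>) s r)"
        using entropy[OF sT _ X[OF \<omega>]] e by simp
      also have "(\<Sum>i<N. exp (?\<kappa> i) * ?\<kappa> i) = (\<Sum>i<N. exp (?\<kappa> i) * qf N (K \<omega>) (eigu N (K \<omega>) i))"
        using sdec_qf_eigenvector[OF sdec_eig[OF hK[OF \<omega>]]] by simp
      also have "\<dots> = Re (\<Sum>r<N. \<Sum>s<N. T \<omega> r s * K \<omega> s r)"
        unfolding sdec_trace_mult[OF sT] by (simp add: qf_def)
      also have "\<dots> = Re (\<Sum>r<N. \<Sum>s<N. T \<omega> r s * H s r) + Re (\<Sum>r<N. \<Sum>s<N. T \<omega> r s * mfun N l (X \<omega>) s r)"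
        unfolding K_def by (simp only: distrib_left sum.distrib plus_complex.sel)
      finally have "F (T \<omega>) + G (A \<omega>) \<le> Re (\<Sum>r<N. \<Sum>s<N. T \<omega> r s * H s r)" by simp
      then show ?thesis unfolding \<Phi>_def tr_eq[OF \<omega>] by simp
    qed
    have "(\<integral>\<omega>. trexp N (K \<omega>) \<partial>M) \<le> (\<integral>\<omega>. \<Phi> (T \<omega>) - G (A \<omega>) \<partial>M)"
    proof (rule integral_mono_AE[OF itr])
      show "integrable M (\<lambda>\<omega>. \<Phi> (T \<omega>) - G (A \<omega>))"
        by (intro Bochner_Integration.integrable_diff lin_integral(1)[OF l\<Phi> iT] lin_integral(1)[OF G iA])
      show "AE \<omega> in M. trexp N (K \<omega>) \<le> \<Phi> (T \<omega>) - G (A \<omega>)"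
        using ae AE_space by eventually_elim (rule pw)
    qed
    also have "\<dots> = \<Phi> Tm - G (\<lambda>r s. \<integral>\<omega>. A \<omega> r s \<partial>M)"
      unfolding Tm_def
      by (simp only: Bochner_Integration.integral_diff[OF lin_integral(1)[OF l\<Phi> iT] lin_integral(1)[OF G iA]]
          lin_integral(2)[OF l\<Phi> iT] lin_integral(2)[OF G iA])
    also have "G (\<lambda>r s. \<integral>\<omega>. A \<omega> r s \<partial>M) = G Am" by (rule lin_cong[OF G EA])
    also have "\<Phi> Tm - G Am \<le> hs N ident Tm + Re (\<Sum>r<N. \<Sum>s<N. Tm r s * H s r)
        - ((\<Sum>i<N. t i * ln (t i)) - Re (\<Sum>r<N. \<Sum>s<N. Tm r s * mfun N l Xm s r)) + \<epsilon>"
      using tight entropy[OF Tm tpos hXm eb] unfolding \<Phi>_def by linarith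
    also have "\<dots> = (\<Sum>i<N. t i) + Re (\<Sum>r<N. \<Sum>s<N. Tm r s * (H s r + mfun N l Xm s r)) - (\<Sum>i<N. t i * ln (t i)) + \<epsilon>"
      unfolding hs_ident sdec_trace[OF Tm] by (simp only: distrib_left sum.distrib plus_complex.sel Re_complex_of_real)
    also have "\<dots> \<le> trexp N (\<lambda>r s. H r s + mfun N l Xm r s) + \<epsilon>"
      unfolding trexp_def
      by (intro add_right_mono gibbs_variational[OF Tm sdec_eig tpos] herm_add H herm_mfun hXm)
    finally show ?thesis .
  qed
  then have "(\<integral>\<omega>. trexp N (K \<omega>) \<partial>M) \<le> trexp N (\<lambda>r s. H r s + mfun N l Xm r s)"
    by (rule field_le_epsilon)
  then show "(\<integral>\<omega>. trexp N (\<lambda>r s. H r s + mfun N l (X \<omega>) r s) \<partial>M)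
      \<le> trexp N (\<lambda>r s. H r s + mfun N l Xm r s)"
    unfolding K_def .
qed

section \<open>Chernoff bounds for sums of random Hermitian matrices\<close>

lemma (in prob_space) indep_var_nn_integral:
  assumes ind: "indep_var S Y T Z" and f: "f \<in> borel_measurable (S \<Otimes>\<^sub>M T)"
  shows "(\<integral>\<^sup>+\<omega>. f (Y \<omega>, Z \<omega>) \<partial>M) = (\<integral>\<^sup>+\<omega>'. \<integral>\<^sup>+\<omega>. f (Y \<omega>', Z \<omega>) \<partial>M \<partial>M)"
proof -
  have Y: "random_variable S Y" and Z: "random_variable T Z"
    and eq: "distr M S Y \<Otimes>\<^sub>M distr M T Z = distr M (S \<Otimes>\<^sub>M T) (\<lambda>\<omega>. (Y \<omega>, Z \<omega>))"
    using ind unfolding indep_var_distribution_eq by auto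
  interpret T: prob_space "distr M T Z" by (rule prob_space_distr[OF Z])
  have f': "f \<in> borel_measurable (distr M S Y \<Otimes>\<^sub>M distr M T Z)" using f by simp
  have YZ: "(\<lambda>\<omega>. (Y \<omega>, Z \<omega>)) \<in> measurable M (S \<Otimes>\<^sub>M T)" using Y Z by simp
  have "(\<integral>\<^sup>+\<omega>. f (Y \<omega>, Z \<omega>) \<partial>M) = (\<integral>\<^sup>+p. f p \<partial>distr M (S \<Otimes>\<^sub>M T) (\<lambda>\<omega>. (Y \<omega>, Z \<omega>)))"
    using f by (intro nn_integral_distr[OF YZ, symmetric]) simp
  also have "\<dots> = (\<integral>\<^sup>+y. \<integral>\<^sup>+z. f (y, z) \<partial>distr M T Z \<partial>distr M S Y)"
    unfolding eq[symmetric] by (rule T.nn_integral_fst[OF f', symmetric])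
  also have "\<dots> = (\<integral>\<^sup>+\<omega>'. \<integral>\<^sup>+z. f (Y \<omega>', z) \<partial>distr M T Z \<partial>M)"
    using T.borel_measurable_nn_integral_fst[OF f'] by (intro nn_integral_distr[OF Y]) simp
  also have "\<dots> = (\<integral>\<^sup>+\<omega>'. \<integral>\<^sup>+\<omega>. f (Y \<omega>', Z \<omega>) \<partial>M \<partial>M)"
  proof (rule nn_integral_cong)
    fix \<omega>' assume "\<omega>' \<in> space M"
    then have "Y \<omega>' \<in> space S" using Y by (rule measurable_space[rotated])
    then have "(\<lambda>z. f (Y \<omega>', z)) \<in> borel_measurable T" using f by simp
    then show "(\<integral>\<^sup>+z. f (Y \<omega>', z) \<partial>distr M T Z) = (\<integral>\<^sup>+\<omega>. f (Y \<omega>', Z \<omega>) \<partial>M)"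
      by (intro nn_integral_distr[OF Z]) simp
  qed
  finally show ?thesis .
qed

text \<open>With the earlier variables frozen, all other summands are absorbed into the fixed matrix
  and Lieb's inequality averages the last one. Its deterministic replacement then joins
  \<open>H\<close>, so the induction must leave \<open>H\<close> arbitrary. Nonnegative integrals
  let Fubini run before integrability of the whole trace is known.\<close>

lemma trexp_sum_le:
  fixes V :: "nat \<Rightarrow> 's \<Rightarrow> 'v" and \<phi> :: "'v \<Rightarrow> cmat" and l :: "real \<Rightarrow> real"
  assumes M: "prob_space M" and ind: "prob_space.indep_vars M (\<lambda>_. S) V {..<n}"
    and \<phi>: "\<And>r s. r < N \<Longrightarrow> s < N \<Longrightarrow> (\<lambda>x. \<phi> x r s) \<in> borel_measurable S" "\<And>x. herm N (\<phi> x)"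
    and int: "\<And>i r s. i < n \<Longrightarrow> r < N \<Longrightarrow> s < N \<Longrightarrow> integrable M (\<lambda>\<omega>. \<phi> (V i \<omega>) r s)"
    and l: "continuous_on UNIV l" and C: "\<And>x. \<bar>l x\<bar> \<le> C"
    and ae: "\<And>i. i < n \<Longrightarrow> AE \<omega> in M. \<forall>j<N. exp (l (eigv N (\<phi> (V i \<omega>)) j)) = 1 + g * eigv N (\<phi> (V i \<omega>)) j"
    and Xm: "\<And>i. Xm i = (\<lambda>r s. \<integral>\<omega>. \<phi> (V i \<omega>) r s \<partial>M)"
    and eb: "\<And>i j. i < n \<Longrightarrow> j < N \<Longrightarrow> exp (l (eigv N (Xm i) j)) = 1 + g * eigv N (Xm i) j"
  shows "k \<le> n \<Longrightarrow> herm N H \<Longrightarrow>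
    (\<integral>\<^sup>+\<omega>. ennreal (trexp N (\<lambda>r s. H r s + (\<Sum>i<k. mfun N l (\<phi> (V i \<omega>)) r s))) \<partial>M)
      \<le> ennreal (trexp N (\<lambda>r s. H r s + (\<Sum>i<k. mfun N l (Xm i) r s)))"
proof (induction k arbitrary: H)
  interpret prob_space M by (rule M)
  case 0
  then show ?case by (simp add: emeasure_space_1)
next
  interpret prob_space M by (rule M)
  case (Suc k)
  then have k: "k < n" "k \<le> n" by auto
  \<comment> \<open>Past and present are both written as restrictions of the family to disjoint
    index sets, the form in which their independence is available; hence the singleton product for
    \<open>V k\<close>.\<close>
  let ?Y = "\<lambda>\<omega>. restrict (\<lambda>i. V i \<omega>) {..<k}" and ?Z = "\<lambda>\<omega>. restrict (\<lambda>i. V i \<omega>) {k}"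
  let ?P = "PiM {..<k} (\<lambda>_. S)" and ?Q = "PiM {k} (\<lambda>_. S)"
  have iv: "indep_var ?P ?Y ?Q ?Z"
    using k by (intro indep_var_restrict[OF ind]) auto
  define B where "B p r s = (H r s + (\<Sum>i<k. mfun N l (\<phi> (fst p i)) r s)) + mfun N l (\<phi> (snd p k)) r s"
    for p :: "(nat \<Rightarrow> 'v) \<times> (nat \<Rightarrow> 'v)" and r s
  have hB: "herm N (B p)" for p
    unfolding B_def by (intro herm_add herm_sum herm_mfun \<phi>(2) Suc.prems(2))
  have m1: "(\<lambda>p. mfun N l (\<phi> (fst p i)) r s) \<in> borel_measurable (?P \<Otimes>\<^sub>M ?Q)"
    if "i < k" "r < N" "s < N" for i r s
  proof (rule measurable_mfun[OF l \<phi>(2) _ that(2,3)])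
    fix r s assume rs: "r < N" "s < N"
    have "(\<lambda>p. fst p i) \<in> measurable (?P \<Otimes>\<^sub>M ?Q) S" 
      using that(1) by (intro measurable_compose[OF measurable_fst measurable_component_singleton]) simp
    from measurable_compose[OF this \<phi>(1)[OF rs]]
    show "(\<lambda>p. \<phi> (fst p i) r s) \<in> borel_measurable (?P \<Otimes>\<^sub>M ?Q)" .
  qed
  have m2: "(\<lambda>p. mfun N l (\<phi> (snd p k)) r s) \<in> borel_measurable (?P \<Otimes>\<^sub>M ?Q)"
    if "r < N" "s < N" for r s
  proof (rule measurable_mfun[OF l \<phi>(2) _ that])
    fix r s assume rs: "r < N" "s < N"
    have "(\<lambda>p. snd p k) \<in> measurable (?P \<Otimes>\<^sub>M ?Q) S"
      by (intro measurable_compose[OF measurable_snd measurable_component_singleton]) simp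
    from measurable_compose[OF this \<phi>(1)[OF rs]]
    show "(\<lambda>p. \<phi> (snd p k) r s) \<in> borel_measurable (?P \<Otimes>\<^sub>M ?Q)" .
  qed
  have mf: "(\<lambda>p. ennreal (trexp N (B p))) \<in> borel_measurable (?P \<Otimes>\<^sub>M ?Q)"
    using m1 m2 by (intro measurable_compose[OF measurable_trexp[OF hB] measurable_ennreal])
      (auto simp: B_def intro!: borel_measurable_add borel_measurable_sum)
  have "(\<integral>\<^sup>+\<omega>. ennreal (trexp N (\<lambda>r s. H r s + (\<Sum>i<Suc k. mfun N l (\<phi> (V i \<omega>)) r s))) \<partial>M)
      = (\<integral>\<^sup>+\<omega>. ennreal (trexp N (B (?Y \<omega>, ?Z \<omega>))) \<partial>M)"
    by (simp add: B_def[abs_def] add.assoc)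
  also have "\<dots> = (\<integral>\<^sup>+\<omega>'. \<integral>\<^sup>+\<omega>. ennreal (trexp N (B (?Y \<omega>', ?Z \<omega>))) \<partial>M \<partial>M)"
    by (rule indep_var_nn_integral[OF iv mf])
  also have "\<dots> \<le> (\<integral>\<^sup>+\<omega>'. ennreal (trexp N (\<lambda>r s. (H r s + mfun N l (Xm k) r s)
      + (\<Sum>i<k. mfun N l (\<phi> (V i \<omega>')) r s))) \<partial>M)"
  proof (rule nn_integral_mono)
    fix \<omega>' assume "\<omega>' \<in> space M"
    let ?H = "\<lambda>r s. H r s + (\<Sum>i<k. mfun N l (\<phi> (V i \<omega>')) r s)"
    have hH: "herm N ?H" by (intro herm_add herm_sum herm_mfun \<phi>(2) Suc.prems(2))
    note lieb = lieb_expectation[OF M hH \<phi>(2) int[OF k(1)] l C ae[OF k(1)] Xm eb[OF k(1)]]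
    have "(\<integral>\<^sup>+\<omega>. ennreal (trexp N (B (?Y \<omega>', ?Z \<omega>))) \<partial>M)
        = (\<integral>\<^sup>+\<omega>. ennreal (trexp N (\<lambda>r s. ?H r s + mfun N l (\<phi> (V k \<omega>)) r s)) \<partial>M)"
      by (simp add: B_def[abs_def])
    also have "\<dots> = ennreal (\<integral>\<omega>. trexp N (\<lambda>r s. ?H r s + mfun N l (\<phi> (V k \<omega>)) r s) \<partial>M)"
      by (intro nn_integral_eq_integral[OF lieb(1)] AE_I2 trexp_nonneg)
    also have "\<dots> \<le> ennreal (trexp N (\<lambda>r s. ?H r s + mfun N l (Xm k) r s))"
      by (rule ennreal_leI[OF lieb(2)])
    finally show "(\<integral>\<^sup>+\<omega>. ennreal (trexp N (B (?Y \<omega>', ?Z \<omega>))) \<partial>M)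
        \<le> ennreal (trexp N (\<lambda>r s. (H r s + mfun N l (Xm k) r s) + (\<Sum>i<k. mfun N l (\<phi> (V i \<omega>')) r s)))"
      by (simp add: add_ac)
  qed
  also have "\<dots> \<le> ennreal (trexp N (\<lambda>r s. (H r s + mfun N l (Xm k) r s) + (\<Sum>i<k. mfun N l (Xm i) r s)))"
    by (intro Suc.IH k(2) herm_add herm_mfun Suc.prems(2)) (unfold Xm, rule herm_integral[OF \<phi>(2)])
  also have "\<dots> = ennreal (trexp N (\<lambda>r s. H r s + (\<Sum>i<Suc k. mfun N l (Xm i) r s)))"
    by (simp add: add_ac)
  finally show ?case .
qed

text \<open>The logarithm of the moment generating function of a Bernoulli variable with mean
  \<open>x\<close>. Clamping \<open>x\<close> to \<open>[0, 1]\<close> makes it continuous and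
  bounded on the whole line, so it applies to every sample point although the spectra lie in
  \<open>[0, 1]\<close> only almost surely.\<close>

definition logmgf :: "real \<Rightarrow> real \<Rightarrow> real" where
  "logmgf t x = ln (1 + (exp t - 1) * max 0 (min 1 x))"

lemma one_plus_pos:
  fixes t x :: real
  assumes "0 \<le> x" "x \<le> 1"
  shows "0 < 1 + (exp t - 1) * x"
proof (cases "x = 1")
  case False
  then have "0 < (1 - x) + exp t * x" using assms by (intro add_pos_nonneg) auto
  then show ?thesis by (simp add: algebra_simps)
qed simp

lemma continuous_logmgf: "continuous_on UNIV (logmgf t)"
proof -
  have "1 + (exp t - 1) * max 0 (min 1 x) \<noteq> 0" for x :: real
    using one_plus_pos[of "max 0 (min 1 x)" t] by auto
  then show ?thesis unfolding logmgf_def[abs_def] by (intro continuous_intros) auto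
qed

lemma exp_logmgf: "0 \<le> x \<Longrightarrow> x \<le> 1 \<Longrightarrow> exp (logmgf t x) = 1 + (exp t - 1) * x"
  unfolding logmgf_def using one_plus_pos[of x t] by simp

lemma logmgf_bound: "\<bar>logmgf t x\<bar> \<le> \<bar>t\<bar>"
proof -
  define c where "c = max 0 (min 1 x)"
  have c: "0 \<le> c" "c \<le> 1" by (auto simp: c_def)
  note pos = one_plus_pos[OF c, of t]
  have "logmgf t x = ln (1 + (exp t - 1) * c)" by (simp add: logmgf_def c_def)
  moreover have "\<bar>ln (1 + (exp t - 1) * c)\<bar> \<le> \<bar>t\<bar>"
  proof (cases "t \<ge> 0")
    case True
    then have "0 \<le> (exp t - 1) * c" "(exp t - 1) * c \<le> (exp t - 1) * 1"
      using c mult_left_mono[of c 1 "exp t - 1"] by auto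
    then have "ln 1 \<le> ln (1 + (exp t - 1) * c)" "ln (1 + (exp t - 1) * c) \<le> ln (exp t)"
      using pos by (simp_all del: ln_exp)
    then show ?thesis using True by simp
  next
    case False
    then have "(exp t - 1) * c \<le> 0" "(exp t - 1) * 1 \<le> (exp t - 1) * c"
      using c mult_left_mono_neg[of c 1 "exp t - 1"] by (auto intro: mult_nonpos_nonneg)
    then have "ln (1 + (exp t - 1) * c) \<le> ln 1" "ln (exp t) \<le> ln (1 + (exp t - 1) * c)"
      using pos by (simp_all del: ln_exp)
    then show ?thesis using False by simp
  qed
  ultimately show ?thesis by simp
qed

text \<open>The chord of the exponential between 0 and \<open>t\<close> lies above its
  graph.\<close>

lemma logmgf_ge:
  assumes "0 \<le> x" "x \<le> 1"
  shows "t * x \<le> logmgf t x"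
proof -
  have "exp ((1 - x) *\<^sub>R 0 + x *\<^sub>R t) \<le> (1 - x) * exp 0 + x * exp t"
    by (rule convex_onD[OF exp_convex]) (use assms in auto)
  then have "exp (t * x) \<le> exp (logmgf t x)"
    unfolding exp_logmgf[OF assms] by (simp add: algebra_simps)
  then show ?thesis by simp
qed

text \<open>The tangent of \<open>ln\<close> at \<open>c\<close>, with \<open>c\<close> left free so
  that the same line can be used for all summands at once.\<close>

lemma logmgf_le_tangent:
  assumes "0 \<le> x" "x \<le> 1" "c > 0"
  shows "logmgf t x \<le> (ln c + (1 - c) / c) + (exp t - 1) / c * x"
proof -
  have "logmgf t x - ln c = ln (1 + (exp t - 1) * x) - ln c"
    using assms by (simp add: logmgf_def)
  also have "\<dots> \<le> (1 + (exp t - 1) * x - c) / c"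
    by (rule ln_diff_le[OF one_plus_pos[OF assms(1,2)] assms(3)])
  also have "\<dots> = (1 - c) / c + (exp t - 1) / c * x" using assms(3) by (simp add: field_simps)
  finally show ?thesis by linarith
qed

section \<open>Spectra in the unit interval and the Laplace bound\<close>

definition unit_spec :: "nat \<Rightarrow> cmat \<Rightarrow> bool" where
  "unit_spec N A \<longleftrightarrow> (\<forall>j<N. 0 \<le> eigv N A j \<and> eigv N A j \<le> 1)"

lemma unit_spec_qf:
  assumes "herm N A" "unit_spec N A" "ip N x x = 1"
  shows "0 \<le> qf N A x" "qf N A x \<le> 1"
proof -
  have eq: "qf N A x = (\<Sum>i<N. eigv N A i * (cmod (ip N (eigu N A i) x))\<^sup>2)"
    by (rule sdec_qf[OF sdec_eig[OF assms(1)]])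
  show "0 \<le> qf N A x"
    unfolding eq using assms(2) by (intro sum_nonneg mult_nonneg_nonneg) (auto simp: unit_spec_def)
  have "qf N A x \<le> (\<Sum>i<N. 1 * (cmod (ip N (eigu N A i) x))\<^sup>2)"
    unfolding eq using assms(2) by (intro sum_mono mult_right_mono) (auto simp: unit_spec_def)
  then show "qf N A x \<le> 1"
    using orthonormal_parseval_norm[OF sdec_orthonormal[OF sdec_eig[OF assms(1)]], of x] assms(3) by simp
qed

lemma unit_specI:
  assumes "herm N A" "\<And>x. ip N x x = 1 \<Longrightarrow> 0 \<le> qf N A x \<and> qf N A x \<le> 1"
  shows "unit_spec N A"
  unfolding unit_spec_def
  using assms(2)[OF sdec_norm[OF sdec_eig[OF assms(1)]]] sdec_qf_eigenvector[OF sdec_eig[OF assms(1)]]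
  by auto

lemma unit_spec_entry:
  assumes "herm N A" "unit_spec N A" "r < N" "s < N"
  shows "cmod (A r s) \<le> real N"
proof -
  have "A r s = mfun N (\<lambda>x. x) A r s"
    using sdec_eig[OF assms(1)] assms(3,4) by (simp add: sdec_def mfun_def)
  then show ?thesis
    using mfun_bound[of N A "\<lambda>x. x" 1 r s] assms by (simp add: unit_spec_def)
qed

lemma unit_spec_integrable:
  assumes M: "prob_space M" and h: "\<And>\<omega>. \<omega> \<in> space M \<Longrightarrow> herm N (X \<omega>)"
    and meas: "(\<lambda>\<omega>. X \<omega> r s) \<in> borel_measurable M"
    and ae: "AE \<omega> in M. unit_spec N (X \<omega>)" and rs: "r < N" "s < N"
  shows "integrable M (\<lambda>\<omega>. X \<omega> r s)"
proof -
  interpret prob_space M by (rule M)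
  show ?thesis
  proof (rule integrable_const_bound[where B = "real N"])
    show "AE \<omega> in M. cmod (X \<omega> r s) \<le> real N"
      using ae AE_space by eventually_elim (rule unit_spec_entry[OF h _ rs])
  qed (rule meas)
qed

lemma unit_spec_integral:
  assumes M: "prob_space M" and h: "\<And>\<omega>. \<omega> \<in> space M \<Longrightarrow> herm N (X \<omega>)"
    and int: "\<And>r s. r < N \<Longrightarrow> s < N \<Longrightarrow> integrable M (\<lambda>\<omega>. X \<omega> r s)"
    and ae: "AE \<omega> in M. unit_spec N (X \<omega>)"
  shows "unit_spec N (\<lambda>r s. \<integral>\<omega>. X \<omega> r s \<partial>M)"
proof (rule unit_specI[OF herm_integral[OF h]])
  interpret prob_space M by (rule M)
  fix x assume x: "ip N x x = 1"
  have ae': "AE \<omega> in M. 0 \<le> qf N (X \<omega>) x \<and> qf N (X \<omega>) x \<le> 1"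
    using ae AE_space by eventually_elim (use unit_spec_qf[OF h _ x] in blast)
  have "0 \<le> (\<integral>\<omega>. qf N (X \<omega>) x \<partial>M)" using ae' by (intro integral_nonneg_AE) auto
  moreover have "(\<integral>\<omega>. qf N (X \<omega>) x \<partial>M) \<le> (\<integral>\<omega>. 1 \<partial>M)"
    using ae' by (intro integral_mono_AE lin_integral(1)[OF lin_qf int]) auto
  ultimately show "0 \<le> qf N (\<lambda>r s. \<integral>\<omega>. X \<omega> r s \<partial>M) x \<and> qf N (\<lambda>r s. \<integral>\<omega>. X \<omega> r s \<partial>M) x \<le> 1"
    using lin_integral(2)[OF lin_qf[of N x] int] by (simp add: prob_space)
qed

text \<open>At an eigenvector of the sum every summand is a scalar, and one common tangent line
  bounds all of them, so that only the average of the quadratic forms is left. The factor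
  \<open>N\<close> counts the eigenvalues, each bounded separately.\<close>

lemma trexp_logmgf_le:
  assumes h: "\<And>i. i < n \<Longrightarrow> herm N (A i)" and us: "\<And>i. i < n \<Longrightarrow> unit_spec N (A i)"
    and \<mu>: "\<And>x. ip N x x = 1 \<Longrightarrow> t * ((\<Sum>i<n. qf N (A i) x) / real n) \<le> t * \<mu>"
    and n: "n > 0"
  shows "trexp N (\<lambda>r s. \<Sum>i<n. mfun N (logmgf t) (A i) r s) \<le> real N * (1 + (exp t - 1) * \<mu>) ^ n"
proof -
  let ?K = "\<lambda>r s. \<Sum>i<n. mfun N (logmgf t) (A i) r s"
  have hK: "herm N ?K" using h by (intro herm_sum herm_mfun) auto
  have "exp (eigv N ?K j) \<le> (1 + (exp t - 1) * \<mu>) ^ n" if j: "j < N" for j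
  proof -
    let ?x = "eigu N ?K j"
    have x: "ip N ?x ?x = 1" by (rule sdec_norm[OF sdec_eig[OF hK] j])
    define q where "q = (\<Sum>i<n. qf N (A i) ?x) / real n"
    have qn: "(\<Sum>i<n. qf N (A i) ?x) = real n * q" using n by (simp add: q_def)
    have "0 \<le> (\<Sum>i<n. qf N (A i) ?x)" "(\<Sum>i<n. qf N (A i) ?x) \<le> (\<Sum>i<n. 1)"
      using unit_spec_qf[OF h us x] by (intro sum_nonneg sum_mono; simp)+
    then have q: "0 \<le> q" "q \<le> 1" using n by (auto simp: q_def field_simps)
    \<comment> \<open>Tangency at the averaged quadratic form \<open>q\<close>: the linear
      corrections then sum to zero and exactly \<open>n * ln c\<close> remains.\<close>
    define c where "c = 1 + (exp t - 1) * q"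
    have c: "c > 0" unfolding c_def by (rule one_plus_pos[OF q])
    have "eigv N ?K j = (\<Sum>i<n. qf N (mfun N (logmgf t) (A i)) ?x)"
      using sdec_qf_eigenvector[OF sdec_eig[OF hK] j] by (simp add: qf_sum)
    also have "\<dots> \<le> (\<Sum>i<n. (ln c + (1 - c) / c) * Re (ip N ?x ?x) + (exp t - 1) / c * qf N (A i) ?x)"
      using h us c by (intro sum_mono qf_mfun_le_affine logmgf_le_tangent) (auto simp: unit_spec_def)
    also have "\<dots> = real n * (ln c + (1 - c) / c) + (exp t - 1) / c * (real n * q)"
      by (simp only: x sum.distrib sum_distrib_left[symmetric] qn) simp
    also have "\<dots> = real n * ln c + real n * ((1 - c + (exp t - 1) * q) / c)"
      using c by (simp add: field_simps)
    also have "1 - c + (exp t - 1) * q = 0" by (simp add: c_def)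
    finally have "exp (eigv N ?K j) \<le> exp (real n * ln c)" by simp
    also have "\<dots> = c ^ n" using c by (simp add: exp_of_nat_mult)
    also have "\<dots> \<le> (1 + (exp t - 1) * \<mu>) ^ n"
    proof (rule power_mono)
      have tq: "t * q \<le> t * \<mu>" unfolding q_def by (rule \<mu>[OF x])
      have "(exp t - 1) * q \<le> (exp t - 1) * \<mu>"
      proof (cases t "0 :: real" rule: linorder_cases)
        case less
        then have "\<mu> \<le> q" using tq by simp
        then show ?thesis using less by (intro mult_left_mono_neg) auto
      next
        case greater
        then have "q \<le> \<mu>" using tq by simp
        then show ?thesis using greater by (intro mult_left_mono) auto
      qed simp
      then show "c \<le> 1 + (exp t - 1) * \<mu>" by (simp add: c_def)
    qed (use c in simp)
    finally show ?thesis .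
  qed
  then have "trexp N ?K \<le> (\<Sum>j<N. (1 + (exp t - 1) * \<mu>) ^ n)"
    unfolding trexp_def by (intro sum_mono) auto
  then show ?thesis by simp
qed

text \<open>Both tails at once: the comparisons for \<mu> and \<theta> carry the factor
  \<open>t\<close>, so a negative \<open>t\<close> reverses them. The event only has to supply a
  unit vector at which the averaged form is extreme; an eigenvector for the largest or smallest
  eigenvalue will do.\<close>

lemma matrix_chernoff_laplace:
  fixes V :: "nat \<Rightarrow> 's \<Rightarrow> 'v" and \<phi> :: "'v \<Rightarrow> cmat"
  assumes M: "prob_space M" and ind: "prob_space.indep_vars M (\<lambda>_. S) V {..<n}"
    and \<phi>: "\<And>r s. r < N \<Longrightarrow> s < N \<Longrightarrow> (\<lambda>x. \<phi> x r s) \<in> borel_measurable S" "\<And>x. herm N (\<phi> x)"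
    and us: "\<And>i. i < n \<Longrightarrow> AE \<omega> in M. unit_spec N (\<phi> (V i \<omega>))"
    and \<mu>: "\<And>x. ip N x x = 1 \<Longrightarrow> t * ((\<Sum>i<n. qf N (\<lambda>r s. \<integral>\<omega>. \<phi> (V i \<omega>) r s \<partial>M) x) / real n) \<le> t * \<mu>"
    and n: "n > 0" and N: "N > 0"
    and E: "\<And>\<omega>. \<omega> \<in> E \<Longrightarrow> \<omega> \<in> space M \<and>
      (\<exists>x. ip N x x = 1 \<and> t * \<theta> \<le> t * ((\<Sum>i<n. qf N (\<phi> (V i \<omega>)) x) / real n))"
  shows "measure M E \<le> real N * (exp (- (t * \<theta>)) * (1 + (exp t - 1) * \<mu>)) ^ n"
proof -
  interpret prob_space M by (rule M)
  have Vm: "V i \<in> measurable M S" if "i < n" for i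
    using ind that unfolding indep_vars_def by auto
  have mX: "(\<lambda>\<omega>. \<phi> (V i \<omega>) r s) \<in> borel_measurable M" if "i < n" "r < N" "s < N" for i r s
    by (rule measurable_compose[OF Vm[OF that(1)] \<phi>(1)[OF that(2,3)]])
  have int: "integrable M (\<lambda>\<omega>. \<phi> (V i \<omega>) r s)" if "i < n" "r < N" "s < N" for i r s
    by (rule unit_spec_integrable[OF M \<phi>(2) mX[OF that] us[OF that(1)] that(2,3)])
  define Xm where "Xm i = (\<lambda>r s. \<integral>\<omega>. \<phi> (V i \<omega>) r s \<partial>M)" for i
  have hXm: "herm N (Xm i)" for i unfolding Xm_def by (rule herm_integral[OF \<phi>(2)])
  have uXm: "unit_spec N (Xm i)" if "i < n" for i
    unfolding Xm_def by (rule unit_spec_integral[OF M \<phi>(2) int[OF that] us[OF that]])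
  let ?l = "logmgf t" and ?O = "\<lambda>r s :: nat. 0 :: complex"
  define K where "K \<omega> r s = ?O r s + (\<Sum>i<n. mfun N ?l (\<phi> (V i \<omega>)) r s)" for \<omega> r s
  have hK: "herm N (K \<omega>)" for \<omega>
    unfolding K_def by (intro herm_add herm_sum herm_mfun \<phi>(2)) (simp add: herm_def)
  have mK: "(\<lambda>\<omega>. trexp N (K \<omega>)) \<in> borel_measurable M"
    by (rule measurable_trexp[OF hK])
      (auto simp: K_def intro!: borel_measurable_sum measurable_mfun[OF continuous_logmgf \<phi>(2)] mX)
  have "(\<integral>\<^sup>+\<omega>. ennreal (trexp N (K \<omega>)) \<partial>M) \<le> ennreal (trexp N (\<lambda>r s. ?O r s + (\<Sum>i<n. mfun N ?l (Xm i) r s)))"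
    unfolding K_def
  proof (rule trexp_sum_le[OF M ind \<phi> int continuous_logmgf logmgf_bound _ Xm_def, where g = "exp t - 1"])
    show "AE \<omega> in M. \<forall>j<N. exp (?l (eigv N (\<phi> (V i \<omega>)) j)) = 1 + (exp t - 1) * eigv N (\<phi> (V i \<omega>)) j"
      if "i < n" for i
      using us[OF that] by eventually_elim (auto simp: unit_spec_def exp_logmgf)
    show "exp (?l (eigv N (Xm i) j)) = 1 + (exp t - 1) * eigv N (Xm i) j" if "i < n" "j < N" for i j
      using uXm[OF that(1)] that(2) by (intro exp_logmgf) (auto simp: unit_spec_def)
  qed (auto simp: herm_def)
  also have "\<dots> \<le> ennreal (real N * (1 + (exp t - 1) * \<mu>) ^ n)"
    using trexp_logmgf_le[of n N Xm t \<mu>] hXm uXm \<mu> n by (intro ennreal_leI) (simp add: Xm_def)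
  finally have le: "(\<integral>\<^sup>+\<omega>. ennreal (trexp N (K \<omega>)) \<partial>M) \<le> ennreal (real N * (1 + (exp t - 1) * \<mu>) ^ n)" .
  have iK: "integrable M (\<lambda>\<omega>. trexp N (K \<omega>))"
    using le by (intro integrableI_nonneg mK) (auto simp: trexp_nonneg intro: le_less_trans)
  have "0 \<le> trexp N (\<lambda>r s. \<Sum>i<n. mfun N ?l (Xm i) r s)" by (rule trexp_nonneg)
  also have "\<dots> \<le> real N * (1 + (exp t - 1) * \<mu>) ^ n"
    using trexp_logmgf_le[of n N Xm t \<mu>] hXm uXm \<mu> n by (simp add: Xm_def)
  finally have "(\<integral>\<omega>. trexp N (K \<omega>) \<partial>M) \<le> real N * (1 + (exp t - 1) * \<mu>) ^ n"
    using le nn_integral_eq_integral[OF iK] by (simp add: trexp_nonneg)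
  then have int_le: "(\<integral>\<omega>. trexp N (K \<omega>) \<partial>M) / exp (real n * (t * \<theta>))
      \<le> real N * (1 + (exp t - 1) * \<mu>) ^ n / exp (real n * (t * \<theta>))"
    by (rule divide_right_mono) simp
  have "AE \<omega> in M. \<forall>i<n. unit_spec N (\<phi> (V i \<omega>))"
    using us by (simp add: AE_all_countable flip: AE_ball_countable)
  then have sub: "AE \<omega> in M. \<omega> \<in> E \<longrightarrow> \<omega> \<in> {\<omega> \<in> space M. trexp N (K \<omega>) \<ge> exp (real n * (t * \<theta>))}"
  proof eventually_elim
    case (elim \<omega>)
    show ?case
    proof
      assume "\<omega> \<in> E"
      from E[OF this] obtain x where \<omega>: "\<omega> \<in> space M" and x: "ip N x x = 1"
        and le: "t * \<theta> \<le> t * ((\<Sum>i<n. qf N (\<phi> (V i \<omega>)) x) / real n)" by blast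
      have "real n * (t * \<theta>) \<le> real n * (t * ((\<Sum>i<n. qf N (\<phi> (V i \<omega>)) x) / real n))"
        by (rule mult_left_mono[OF le]) simp
      also have "\<dots> = t * (\<Sum>i<n. qf N (\<phi> (V i \<omega>)) x)" using n by simp
      also have "\<dots> = (\<Sum>i<n. 0 * Re (ip N x x) + t * qf N (\<phi> (V i \<omega>)) x)"
        by (simp add: sum_distrib_left)
      also have "\<dots> \<le> (\<Sum>i<n. qf N (mfun N ?l (\<phi> (V i \<omega>))) x)"
        using elim by (intro sum_mono qf_mfun_ge_affine \<phi>(2)) (auto simp: unit_spec_def intro: logmgf_ge)
      also have "\<dots> = qf N (K \<omega>) x"
        unfolding K_def by (simp add: qf_sum)
      finally have "exp (real n * (t * \<theta>)) \<le> exp (qf N (K \<omega>) x)" by simp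
      also have "\<dots> \<le> trexp N (K \<omega>)" by (rule exp_qf_le_trexp[OF hK x N])
      finally show "\<omega> \<in> {\<omega> \<in> space M. trexp N (K \<omega>) \<ge> exp (real n * (t * \<theta>))}" using \<omega> by simp
    qed
  qed
  have "measure M E \<le> measure M {\<omega> \<in> space M. trexp N (K \<omega>) \<ge> exp (real n * (t * \<theta>))}"
  \<comment> \<open>Measurability of the event is not established; outside \<open>sets M\<close> the
    function \<open>measure\<close> takes its default value 0 and the bound is trivial.\<close>
  proof (cases "E \<in> sets M")
    case True
    then show ?thesis using sub mK by (intro finite_measure_mono_AE) auto
  qed (simp add: measure_notin_sets)
  also have "\<dots> \<le> (\<integral>\<omega>. trexp N (K \<omega>) \<partial>M) / exp (real n * (t * \<theta>))"
    by (rule integral_Markov_inequality_measure[OF iK sets.empty_sets]) (auto simp: trexp_nonneg)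
  also note int_le
  also have "real N * (1 + (exp t - 1) * \<mu>) ^ n / exp (real n * (t * \<theta>))
      = real N * (exp (- (t * \<theta>)) * (1 + (exp t - 1) * \<mu>)) ^ n"
    unfolding exp_of_nat_mult exp_minus power_mult_distrib power_inverse divide_inverse
    by (simp add: mult_ac)
  finally show ?thesis .
qed

section \<open>Optimization over the Laplace parameter\<close>

lemma le_of_tendsto:
  fixes f :: "nat \<Rightarrow> real"
  assumes "f \<longlonglongrightarrow> L" "\<And>k. P \<le> f k"
  shows "P \<le> L"
  using assms by (intro LIMSEQ_le_const) auto

text \<open>The best \<open>t\<close> is 0 for \<open>\<theta> = \<mu>\<close> and a finite
  stationary point for \<open>0 < \<mu> < \<theta> < 1\<close>. For
  \<open>\<mu> = 0 < \<theta>\<close> and for \<open>\<mu> < \<theta> = 1\<close> the infimum is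
  reached only as \<open>t\<close> tends to infinity, taken along the integers.\<close>

lemma chernoff_optimize_upper:
  fixes P c \<mu> \<theta> :: real and n :: nat
  assumes \<mu>: "0 \<le> \<mu>" "\<mu> \<le> \<theta>" "\<theta> \<le> 1" and n: "n > 0" and c: "c \<ge> 0"
    and P: "\<And>t. t \<ge> 0 \<Longrightarrow> P \<le> c * (exp (- (t * \<theta>)) * (1 + (exp t - 1) * \<mu>)) ^ n"
  shows "P \<le> c * exp_neg (ereal (real n) * bin_div \<theta> \<mu>)"
proof -
  have lim: "(\<lambda>k. exp (- (real k * a))) \<longlonglongrightarrow> 0" if "a > 0" for a :: real
  proof -
    have "(\<lambda>k. exp (- a) ^ k) \<longlonglongrightarrow> 0" using that by (intro LIMSEQ_power_zero) simp
    then show ?thesis by (simp add: exp_of_nat_mult[symmetric])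
  qed
  consider "\<theta> = \<mu>" | "\<mu> = 0" "\<theta> > 0" | "0 < \<mu>" "\<mu> < 1" "\<theta> = 1" | "0 < \<mu>" "\<mu> < \<theta>" "\<theta> < 1"
    using \<mu> by linarith
  then show ?thesis
  proof cases
    case 1
    then have "bin_div \<theta> \<mu> = 0" using \<mu> by (simp add: bin_div_def xlogxy_def zero_ereal_def)
    then show ?thesis using P[of 0] by (simp add: exp_neg_def)
  next
    case 2
    \<comment> \<open>Infinite divergence makes the claimed bound 0; the limit
      \<open>c * 0 ^ n\<close> matches it because \<open>n > 0\<close>.\<close>
    then have "bin_div \<theta> \<mu> = \<infinity>" by (simp add: bin_div_def xlogxy_def)
    then have D: "exp_neg (ereal (real n) * bin_div \<theta> \<mu>) = 0" using n by (simp add: exp_neg_def)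
    have "(\<lambda>k. c * exp (- (real k * \<theta>)) ^ n) \<longlonglongrightarrow> c * 0 ^ n"
      by (intro tendsto_intros lim 2)
    then have "P \<le> c * 0 ^ n" by (rule le_of_tendsto) (use P[of "real _"] 2 in simp)
    then show ?thesis using D n by (simp add: zero_power)
  next
    case 3
    then have "bin_div \<theta> \<mu> = ereal (ln (1 / \<mu>))" by (simp add: bin_div_def xlogxy_def)
    then have "exp_neg (ereal (real n) * bin_div \<theta> \<mu>) = exp (real n * ln \<mu>)"
      using 3 by (simp add: exp_neg_def ln_div)
    also have "\<dots> = \<mu> ^ n" using 3 by (simp add: exp_of_nat_mult)
    finally have D: "exp_neg (ereal (real n) * bin_div \<theta> \<mu>) = \<mu> ^ n" .
    have "(\<lambda>k. c * (\<mu> + (1 - \<mu>) * exp (- (real k * 1))) ^ n) \<longlonglongrightarrow> c * (\<mu> + (1 - \<mu>) * 0) ^ n"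
      by (intro tendsto_intros lim) simp
    moreover have "P \<le> c * (\<mu> + (1 - \<mu>) * exp (- (real k * 1))) ^ n" for k
    proof -
      have "exp (- (real k * \<theta>)) * (1 + (exp (real k) - 1) * \<mu>) = \<mu> + (1 - \<mu>) * exp (- (real k * 1))"
        using 3 by (simp add: algebra_simps flip: exp_add)
      then show ?thesis using P[of "real k"] by simp
    qed
    ultimately have "P \<le> c * (\<mu> + (1 - \<mu>) * 0) ^ n" by (rule le_of_tendsto)
    then show ?thesis using D by simp
  next
    case 4
    \<comment> \<open>The zero of the derivative of
      \<open>- t * \<theta> + ln (1 + (exp t - 1) * \<mu>)\<close>. It is nonnegative because
      \<open>\<mu> \<le> \<theta>\<close>.\<close>
    define t where "t = ln (\<theta> * (1 - \<mu>) / (\<mu> * (1 - \<theta>)))"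
    have et: "exp t = \<theta> * (1 - \<mu>) / (\<mu> * (1 - \<theta>))" unfolding t_def using 4 by simp
    have "1 \<le> \<theta> * (1 - \<mu>) / (\<mu> * (1 - \<theta>))" using 4 by (simp add: field_simps)
    then have t0: "t \<ge> 0" unfolding t_def by (rule ln_ge_zero)
    have tl: "t = ln \<theta> + ln (1 - \<mu>) - ln \<mu> - ln (1 - \<theta>)"
      unfolding t_def using 4 by (simp add: ln_div ln_mult)
    define d where "d = \<theta> * ln (\<theta> / \<mu>) + (1 - \<theta>) * ln ((1 - \<theta>) / (1 - \<mu>))"
    have "bin_div \<theta> \<mu> = ereal d" using 4 by (simp add: bin_div_def xlogxy_def d_def)
    then have D: "exp_neg (ereal (real n) * bin_div \<theta> \<mu>) = exp (- d) ^ n"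
      by (simp add: exp_neg_def flip: exp_of_nat_mult)
    have "1 + (exp t - 1) * \<mu> = (1 - \<mu>) / (1 - \<theta>)"
      unfolding et using 4 by (simp add: field_simps)
    also have "\<dots> = exp (ln (1 - \<mu>) - ln (1 - \<theta>))" using 4 by (simp add: exp_diff)
    finally have "exp (- (t * \<theta>)) * (1 + (exp t - 1) * \<mu>) = exp (- (t * \<theta>) + (ln (1 - \<mu>) - ln (1 - \<theta>)))"
      by (simp only: exp_add)
    also have "- (t * \<theta>) + (ln (1 - \<mu>) - ln (1 - \<theta>)) = - d"
      unfolding tl d_def using 4 by (simp add: ln_div algebra_simps)
    finally show ?thesis using P[OF t0] D by simp
  qed
qed

text \<open>Exchanging success and failure: replacing \<theta>, \<mu>, \<open>t\<close> by
  \<open>1 - \<theta>\<close>, \<open>1 - \<mu>\<close>, \<open>- t\<close> leaves both the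
  divergence and the Laplace factor unchanged.\<close>

lemma chernoff_optimize_lower:
  fixes P c \<mu> \<theta> :: real and n :: nat
  assumes \<mu>: "0 \<le> \<theta>" "\<theta> \<le> \<mu>" "\<mu> \<le> 1" and n: "n > 0" and c: "c \<ge> 0"
    and P: "\<And>t. t \<le> 0 \<Longrightarrow> P \<le> c * (exp (- (t * \<theta>)) * (1 + (exp t - 1) * \<mu>)) ^ n"
  shows "P \<le> c * exp_neg (ereal (real n) * bin_div \<theta> \<mu>)"
proof -
  have "P \<le> c * exp_neg (ereal (real n) * bin_div (1 - \<theta>) (1 - \<mu>))"
  proof (rule chernoff_optimize_upper[OF _ _ _ n c])
    fix t :: real assume "t \<ge> 0"
    have "exp (- (t * (1 - \<theta>))) * (1 + (exp t - 1) * (1 - \<mu>))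
        = exp (t * \<theta>) * (exp (- t) * (exp t + \<mu> - exp t * \<mu>))"
      by (simp add: algebra_simps flip: exp_add)
    also have "exp (- t) * (exp t + \<mu> - exp t * \<mu>) = 1 + (exp (- t) - 1) * \<mu>"
      by (simp add: algebra_simps exp_minus)
    finally show "P \<le> c * (exp (- (t * (1 - \<theta>))) * (1 + (exp t - 1) * (1 - \<mu>))) ^ n"
      using P[of "- t"] \<open>t \<ge> 0\<close> by simp
  qed (use \<mu> in auto)
  then show ?thesis by (simp add: bin_div_def add.commute)
qed

section \<open>Block circulant matrices\<close>

definition bcf :: "nat \<Rightarrow> nat \<Rightarrow> tensor \<Rightarrow> cmat" where
  "bcf m p T r s = T (r mod m) (s mod m) (nat ((int (r div m) - int (s div m)) mod int p))"

lemma bcirc_bcf: "bcirc m p T = mat (m * p) (m * p) (\<lambda>(r, s). bcf m p T r s)"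
  by (simp add: bcirc_def bcf_def)

lemma block_index_less: "p \<ge> 1 \<Longrightarrow> nat (a mod int p) < p"
  by (simp add: nat_less_iff)

lemma herm_bcf:
  assumes "m \<ge> 1" "p \<ge> 1" and T: "tensor_hermitian m p T"
  shows "herm (m * p) (bcf m p T)"
  unfolding herm_def
proof (intro allI impI)
  fix r s
  let ?a = "int (r div m)" and ?b = "int (s div m)"
  let ?k = "nat ((?a - ?b) mod int p)"
  have k: "?k < p" using assms(2) by (rule block_index_less)
  \<comment> \<open>Reversing the slices negates the block difference modulo \<open>p\<close>, which
    is what transposing the blocks does; the outer \<open>mod p\<close> keeps slice 0 in
    place.\<close>
  have "int ((p - ?k) mod p) = (int p - (?a - ?b) mod int p) mod int p"
    using k assms(2) by (simp add: zmod_int of_nat_diff)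
  also have "\<dots> = (?b - ?a) mod int p" by (simp add: mod_simps)
  finally have "(p - ?k) mod p = nat ((?b - ?a) mod int p)" by linarith
  moreover have "T (r mod m) (s mod m) ?k = cnj (T (s mod m) (r mod m) ((p - ?k) mod p))"
    using T assms(1) k unfolding tensor_hermitian_def tensor_ct_def by simp
  ultimately show "bcf m p T r s = cnj (bcf m p T s r)" by (simp add: bcf_def)
qed

text \<open>Any eigenvector has a nonzero coefficient against some \<open>u i\<close>, and comparing
  that coefficient on both sides of the eigenvalue equation forces the value
  \<open>lam i\<close>.\<close>

lemma sdec_eigenvalues:
  assumes "sdec N A lam u"
  shows "{k. eigenvalue (mat N N (\<lambda>(r, s). A r s)) k} = (\<lambda>i. complex_of_real (lam i)) ` {..<N}"
proof (intro equalityI subsetI)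
  let ?A = "mat N N (\<lambda>(r, s). A r s)"
  have mv: "vec_index (?A *\<^sub>v v) r = (\<Sum>s<N. A r s * vec_index v s)"
    if "r < N" "v \<in> carrier_vec N" for v r
    using that by (simp add: scalar_prod_def atLeast0LessThan)
  {
    fix k assume "k \<in> {k. eigenvalue ?A k}"
    then obtain v where v: "v \<in> carrier_vec N" "v \<noteq> 0\<^sub>v N" "?A *\<^sub>v v = k \<cdot>\<^sub>v v"
      by (auto simp: eigenvalue_def eigenvector_def)
    have Av: "(\<Sum>s<N. A r s * vec_index v s) = k * vec_index v r" if "r < N" for r
      using mv[OF that v(1)] v that by simp
    have "\<exists>i<N. ip N (u i) (vec_index v) \<noteq> 0"
    proof (rule ccontr)
      assume "\<not> ?thesis"
      then have "(\<Sum>i<N. (cmod (ip N (u i) (vec_index v)))\<^sup>2) = 0" by simp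
      then have "(\<Sum>r<N. (cmod (vec_index v r))\<^sup>2) = 0"
        using orthonormal_parseval_norm[OF sdec_orthonormal[OF assms], of "vec_index v"]
        by (simp add: ip_self del: of_real_sum of_real_power)
      then have "\<forall>r<N. vec_index v r = 0" by (simp add: sum_nonneg_eq_0_iff)
      then have "v = 0\<^sub>v N" using v(1) by auto
      then show False using v(2) by simp
    qed
    then obtain i where i: "i < N" and ne: "ip N (u i) (vec_index v) \<noteq> 0" by blast
    have "lam i * ip N (u i) (vec_index v) = bil N A (u i) (vec_index v)"
      by (rule bil_sdec_left[OF assms i, symmetric])
    also have "\<dots> = k * ip N (u i) (vec_index v)"
      unfolding bil_ip using Av by (simp add: ip_def sum_distrib_left mult_ac)
    finally have "k = lam i" using ne by simp
    then show "k \<in> (\<lambda>i. complex_of_real (lam i)) ` {..<N}" using i by auto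
  next
    fix k assume "k \<in> (\<lambda>i. complex_of_real (lam i)) ` {..<N}"
    then obtain i where i: "i < N" and k: "k = lam i" by auto
    let ?v = "vec N (u i)"
    have "?A *\<^sub>v ?v = k \<cdot>\<^sub>v ?v"
    proof (rule eq_vecI)
      fix r assume "r < dim_vec (k \<cdot>\<^sub>v ?v)"
      then have r: "r < N" by simp
      have "vec_index (?A *\<^sub>v ?v) r = (\<Sum>s<N. A r s * u i s)"
        unfolding mv[OF r vec_carrier] by (intro sum.cong) auto
      then show "vec_index (?A *\<^sub>v ?v) r = vec_index (k \<cdot>\<^sub>v ?v) r"
        using sdec_eigen[OF assms i r] r k by simp
    qed simp
    moreover have "?v \<noteq> 0\<^sub>v N"
    proof
      assume "?v = 0\<^sub>v N"
      then have "u i r = 0" if "r < N" for r using that by (metis index_vec index_zero_vec(1))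
      then have "ip N (u i) (u i) = 0" by (simp add: ip_def)
      then show False using sdec_norm[OF assms i] by simp
    qed
    ultimately show "k \<in> {k. eigenvalue ?A k}"
      unfolding mem_Collect_eq eigenvalue_def eigenvector_def by (intro exI[of _ ?v]) simp
  }
qed

lemma lambda_eq:
  assumes "herm (m * p) (bcf m p T)"
  shows "lambda_max m p T = Max (eigv (m * p) (bcf m p T) ` {..<m * p})"
    and "lambda_min m p T = Min (eigv (m * p) (bcf m p T) ` {..<m * p})"
  unfolding lambda_max_def lambda_min_def bcirc_bcf sdec_eigenvalues[OF sdec_eig[OF assms]]
  by (simp_all add: image_image)

lemma rayleigh_bounds:
  assumes h: "herm (m * p) (bcf m p T)" and x: "ip (m * p) x x = 1"
  shows "qf (m * p) (bcf m p T) x \<le> lambda_max m p T" "lambda_min m p T \<le> qf (m * p) (bcf m p T) x"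
proof -
  let ?N = "m * p" and ?A = "bcf m p T"
  have one: "(\<Sum>i<?N. (cmod (ip ?N (eigu ?N ?A i) x))\<^sup>2) = 1"
    using orthonormal_parseval_norm[OF sdec_orthonormal[OF sdec_eig[OF h]], of x] x by simp
  have eq: "qf ?N ?A x = (\<Sum>i<?N. eigv ?N ?A i * (cmod (ip ?N (eigu ?N ?A i) x))\<^sup>2)"
    by (rule sdec_qf[OF sdec_eig[OF h]])
  have "qf ?N ?A x \<le> (\<Sum>i<?N. lambda_max m p T * (cmod (ip ?N (eigu ?N ?A i) x))\<^sup>2)"
    unfolding eq lambda_eq(1)[OF h] by (intro sum_mono mult_right_mono Max_ge) auto
  then show "qf ?N ?A x \<le> lambda_max m p T" by (simp add: one flip: sum_distrib_left)
  have "(\<Sum>i<?N. lambda_min m p T * (cmod (ip ?N (eigu ?N ?A i) x))\<^sup>2) \<le> qf ?N ?A x"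
    unfolding eq lambda_eq(2)[OF h] by (intro sum_mono mult_right_mono Min_le) auto
  then show "lambda_min m p T \<le> qf ?N ?A x" by (simp add: one flip: sum_distrib_left)
qed

lemma rayleigh_attained:
  assumes h: "herm (m * p) (bcf m p T)" and N: "m * p > 0"
  shows "\<exists>x. ip (m * p) x x = 1 \<and> qf (m * p) (bcf m p T) x = lambda_max m p T"
    and "\<exists>x. ip (m * p) x x = 1 \<and> qf (m * p) (bcf m p T) x = lambda_min m p T"
proof -
  let ?N = "m * p" and ?A = "bcf m p T"
  have ex: "\<exists>x. ip ?N x x = 1 \<and> qf ?N ?A x = y" if "y \<in> eigv ?N ?A ` {..<?N}" for y
    using that sdec_norm[OF sdec_eig[OF h]] sdec_qf_eigenvector[OF sdec_eig[OF h]] by blast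
  have ne: "finite (eigv ?N ?A ` {..<?N})" "eigv ?N ?A ` {..<?N} \<noteq> {}"
    using N by (auto simp: lessThan_empty_iff)
  show "\<exists>x. ip ?N x x = 1 \<and> qf ?N ?A x = lambda_max m p T"
    unfolding lambda_eq(1)[OF h] by (rule ex[OF Max_in[OF ne]])
  show "\<exists>x. ip ?N x x = 1 \<and> qf ?N ?A x = lambda_min m p T"
    unfolding lambda_eq(2)[OF h] by (rule ex[OF Min_in[OF ne]])
qed

lemma psd_bcirc_qf:
  assumes "tensor_le m p tensor_zero T"
  shows "0 \<le> qf (m * p) (bcf m p T) x"
proof -
  have "psd_mat (bcirc m p T)" using assms unfolding tensor_le_def tensor_zero_def by simp
  moreover have "dim_row (bcirc m p T) = m * p" by (simp add: bcirc_def)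
  ultimately have "Re (\<Sum>i<m * p. \<Sum>j<m * p. cnj (x i) * index_mat (bcirc m p T) (i, j) * x j) \<ge> 0"
    unfolding psd_mat_def Let_def by (elim conjE allE[of _ x]) (simp only:)
  then show ?thesis by (simp add: qf_def bil_def bcirc_bcf)
qed

lemma qf_average:
  assumes "\<And>r s. r < N \<Longrightarrow> s < N \<Longrightarrow> A r s = 1 / of_nat n * (\<Sum>i<n. B i r s)"
  shows "qf N A x = (\<Sum>i<n. qf N (B i) x) / real n"
proof -
  have "qf N A x = qf N (\<lambda>r s. 1 / of_nat n * (\<Sum>i<n. B i r s)) x"
    by (rule qf_cong) (rule assms)
  also have "\<dots> = Re ((1 / of_nat n) * (\<Sum>i<n. bil N (B i) x x))"
    unfolding qf_def bil_scale bil_sum ..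
  also have "\<dots> = (\<Sum>i<n. qf N (B i) x) / real n"
    by (simp add: qf_def)
  finally show ?thesis .
qed

lemma herm_average:
  assumes "\<And>r s. r < N \<Longrightarrow> s < N \<Longrightarrow> A r s = 1 / of_nat n * (\<Sum>i<n. B i r s)"
    and "\<And>i. i < n \<Longrightarrow> herm N (B i)"
  shows "herm N A"
proof -
  have "herm N (\<lambda>r s. \<Sum>i<n. B i r s)" by (intro herm_sum assms(2)) simp
  then have eq: "(\<Sum>i<n. B i r s) = cnj (\<Sum>i<n. B i s r)" if "r < N" "s < N" for r s
    using that unfolding herm_def by blast
  show ?thesis unfolding herm_def
  proof (intro allI impI)
    fix r s assume rs: "r < N" "s < N"
    have "A r s = 1 / of_nat n * cnj (\<Sum>i<n. B i s r)"
      unfolding assms(1)[OF rs] by (rule arg_cong[OF eq[OF rs]])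
    also have "\<dots> = cnj (A s r)" unfolding assms(1)[OF rs(2,1)] by simp
    finally show "A r s = cnj (A s r)" .
  qed
qed

section \<open>The two tail bounds for tensors\<close>

theorem theorem3:
  fixes M :: "'s measure" and m p n :: nat and X :: "nat \<Rightarrow> 's \<Rightarrow> tensor"
  assumes "prob_space M"
    and "m \<ge> 1" and "p \<ge> 1" and "n \<ge> 1"
    and meas: "\<And>i a b c. i < n \<Longrightarrow> a < m \<Longrightarrow> b < m \<Longrightarrow> c < p \<Longrightarrow>
               (\<lambda>\<omega>. X i \<omega> a b c) \<in> borel_measurable M"
    and indep: "prob_space.indep_vars M
                  (\<lambda>_. PiM ({..<m} \<times> {..<m} \<times> {..<p}) (\<lambda>_. borel :: complex measure))
                  (\<lambda>i \<omega>. restrict (\<lambda>(a, b, c). X i \<omega> a b c) ({..<m} \<times> {..<m} \<times> {..<p}))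
                  {..<n}"
    and herm: "\<And>i \<omega>. i < n \<Longrightarrow> \<omega> \<in> space M \<Longrightarrow> tensor_hermitian m p (X i \<omega>)"
    and psd: "\<And>i. i < n \<Longrightarrow> AE \<omega> in M. tensor_le m p tensor_zero (X i \<omega>)"
    and bnd: "\<And>i. i < n \<Longrightarrow> AE \<omega> in M. lambda_max m p (X i \<omega>) \<le> 1"
  defines "Emean \<equiv> (\<lambda>a b c. (1 / of_nat n) * (\<Sum>i<n. integral\<^sup>L M (\<lambda>\<omega>. X i \<omega> a b c)))"
    and "S \<equiv> (\<lambda>\<omega> a b c. (1 / of_nat n) * (\<Sum>i<n. X i \<omega> a b c))"
  shows "(\<forall>\<theta>. lambda_max m p Emean \<le> \<theta> \<and> \<theta> \<le> 1 \<longrightarrow>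
           measure M {\<omega> \<in> space M. lambda_max m p (S \<omega>) \<ge> \<theta>}
             \<le> real (m * p) * exp_neg (ereal (real n) * bin_div \<theta> (lambda_max m p Emean))) \<and>
         (\<forall>\<theta>. 0 \<le> \<theta> \<and> \<theta> \<le> lambda_min m p Emean \<longrightarrow>
           measure M {\<omega> \<in> space M. lambda_min m p (S \<omega>) \<le> \<theta>}
             \<le> real (m * p) * exp_neg (ereal (real n) * bin_div \<theta> (lambda_min m p Emean)))"
proof -
  interpret prob_space M by fact
  note M = \<open>prob_space M\<close> and mp = \<open>m \<ge> 1\<close> \<open>p \<ge> 1\<close>
  define N where "N = m * p"
  have N: "N > 0" and n: "n > 0" using assms(2-4) by (auto simp: N_def)
  let ?I = "{..<m} \<times> {..<m} \<times> {..<p}"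
  define V where "V i \<omega> = restrict (\<lambda>(a, b, c). X i \<omega> a b c) ?I" for i \<omega>
  let ?S = "PiM ?I (\<lambda>_. borel :: complex measure)"
  have ind: "indep_vars (\<lambda>_. ?S) V {..<n}"
    using indep unfolding V_def .
  define arr where "arr x a b c = x (a, b, c)" for x :: "nat \<times> nat \<times> nat \<Rightarrow> complex" and a b c
  \<comment> \<open>The Hermitian part of the block circulant matrix: Hermitian at every point of the product
    space, not just at those that come from a Hermitian tensor.\<close>
  define \<phi> where "\<phi> x r s = (bcf m p (arr x) r s + cnj (bcf m p (arr x) s r)) / 2" for x r s
  have h\<phi>: "herm N (\<phi> x)" for x unfolding herm_def \<phi>_def by (simp add: add.commute)
  have idx: "(r mod m, s mod m, nat ((int (r div m) - int (s div m)) mod int p)) \<in> ?I" for r s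
    using mp block_index_less by simp
  have mb: "(\<lambda>x. bcf m p (arr x) r s) \<in> borel_measurable ?S" for r s
    unfolding bcf_def arr_def by (rule measurable_component_singleton[OF idx])
  have m\<phi>: "(\<lambda>x. \<phi> x r s) \<in> borel_measurable ?S" for r s
    unfolding \<phi>_def
    by (intro borel_measurable_divide borel_measurable_add mb borel_measurable_const
        measurable_compose[OF mb borel_measurable_continuous_onI[OF continuous_on_cnj[OF continuous_on_id]]])
  have hX: "herm N (bcf m p (X i \<omega>))" if "i < n" "\<omega> \<in> space M" for i \<omega>
    unfolding N_def by (rule herm_bcf[OF mp herm[OF that]])
  have bV: "bcf m p (arr (V i \<omega>)) r s = bcf m p (X i \<omega>) r s" for i \<omega> r s
    unfolding bcf_def arr_def V_def by (simp only: restrict_apply' idx prod.case)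
  have \<phi>V: "\<phi> (V i \<omega>) r s = bcf m p (X i \<omega>) r s" if "i < n" "\<omega> \<in> space M" "r < N" "s < N" for i \<omega> r s
  proof -
    have "bcf m p (X i \<omega>) r s = cnj (bcf m p (X i \<omega>) s r)"
      using hX[OF that(1,2)] that(3,4) unfolding herm_def by blast
    then show ?thesis unfolding \<phi>_def bV by simp
  qed
  have us: "AE \<omega> in M. unit_spec N (\<phi> (V i \<omega>))" if i: "i < n" for i
    using psd[OF i] bnd[OF i] AE_space
  proof eventually_elim
    case (elim \<omega>)
    have q: "qf N (\<phi> (V i \<omega>)) x = qf N (bcf m p (X i \<omega>)) x" for x
      by (rule qf_cong) (rule \<phi>V[OF i elim(3)])
    show ?case
    proof (rule unit_specI[OF h\<phi>])
      fix x assume "ip N x x = 1"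
      then have "qf N (bcf m p (X i \<omega>)) x \<le> lambda_max m p (X i \<omega>)"
        unfolding N_def by (rule rayleigh_bounds(1)[OF hX[OF i elim(3), unfolded N_def]])
      moreover have "0 \<le> qf N (bcf m p (X i \<omega>)) x" unfolding N_def by (rule psd_bcirc_qf[OF elim(1)])
      ultimately show "0 \<le> qf N (\<phi> (V i \<omega>)) x \<and> qf N (\<phi> (V i \<omega>)) x \<le> 1"
        unfolding q using elim(2) by simp
    qed
  qed
  define Xm where "Xm i = (\<lambda>r s. \<integral>\<omega>. \<phi> (V i \<omega>) r s \<partial>M)" for i
  have hXm: "herm N (Xm i)" for i unfolding Xm_def by (rule herm_integral[OF h\<phi>])
  have Vm: "V i \<in> measurable M ?S" if "i < n" for i
    using ind that unfolding indep_vars_def by auto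
  have uXm: "unit_spec N (Xm i)" if i: "i < n" for i
    unfolding Xm_def
    by (intro unit_spec_integral[OF M h\<phi> _ us[OF i]]
        unit_spec_integrable[OF M h\<phi> measurable_compose[OF Vm[OF i] m\<phi>] us[OF i]])
  \<comment> \<open>Every entry of the block circulant matrix is an entry of the tensor, so
    entrywise expectation and averaging pass through it.\<close>
  have Em: "bcf m p Emean r s = 1 / of_nat n * (\<Sum>i<n. Xm i r s)" if "r < N" "s < N" for r s
  proof -
    have "Xm i r s = (\<integral>\<omega>. bcf m p (X i \<omega>) r s \<partial>M)" if i: "i < n" for i
      unfolding Xm_def by (intro Bochner_Integration.integral_cong refl \<phi>V i \<open>r < N\<close> \<open>s < N\<close>)
    then show ?thesis by (simp add: Emean_def bcf_def)
  qed
  have hE: "herm (m * p) (bcf m p Emean)" using herm_average[OF Em hXm] unfolding N_def .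
  have Sm: "bcf m p (S \<omega>) r s = 1 / of_nat n * (\<Sum>i<n. \<phi> (V i \<omega>) r s)"
    if "\<omega> \<in> space M" "r < N" "s < N" for \<omega> r s
    using \<phi>V[OF _ that] by (simp add: S_def bcf_def)
  have hS: "herm (m * p) (bcf m p (S \<omega>))" if "\<omega> \<in> space M" for \<omega>
    using herm_average[OF Sm[OF that] h\<phi>] unfolding N_def .
  have qE: "(\<Sum>i<n. qf N (Xm i) x) / real n = qf (m * p) (bcf m p Emean) x" for x
    using qf_average[OF Em] unfolding N_def by simp
  have qS: "(\<Sum>i<n. qf N (\<phi> (V i \<omega>)) x) / real n = qf (m * p) (bcf m p (S \<omega>)) x"
    if "\<omega> \<in> space M" for \<omega> x
    using qf_average[OF Sm[OF that]] unfolding N_def by simp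
  have qE01: "0 \<le> qf (m * p) (bcf m p Emean) x \<and> qf (m * p) (bcf m p Emean) x \<le> 1"
    if x: "ip (m * p) x x = 1" for x
  proof -
    have "0 \<le> (\<Sum>i<n. qf N (Xm i) x)" "(\<Sum>i<n. qf N (Xm i) x) \<le> (\<Sum>i<n. 1)"
      using unit_spec_qf[OF hXm uXm x[folded N_def]] by (intro sum_nonneg sum_mono; simp)+
    then show ?thesis unfolding qE[symmetric] using n by (simp add: field_simps)
  qed
  have N': "m * p > 0" using N by (simp add: N_def)
  \<comment> \<open>The outer inequalities required by the two optimizations; the average of the
    means inherits its spectral bounds from the summands.\<close>
  have max0: "0 \<le> lambda_max m p Emean" and min1: "lambda_min m p Emean \<le> 1"
    using rayleigh_attained[OF hE N'] qE01 by metis+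
  \<comment> \<open>Rewriting with \<open>qE\<close> turns the condition on the averaged forms of
    the means into one on the quadratic form of \<open>Emean\<close>, where the Rayleigh bounds
    apply.\<close>
  note laplace = matrix_chernoff_laplace[where \<phi> = \<phi> and V = V, OF M ind m\<phi> h\<phi> us _ n N, folded Xm_def, unfolded qE]
  have "measure M {\<omega> \<in> space M. lambda_max m p (S \<omega>) \<ge> \<theta>}
      \<le> real N * (exp (- (t * \<theta>)) * (1 + (exp t - 1) * lambda_max m p Emean)) ^ n"
    if t: "t \<ge> 0" for t \<theta>
  proof (rule laplace)
    show "t * qf (m * p) (bcf m p Emean) x \<le> t * lambda_max m p Emean" if "ip N x x = 1" for x
      using rayleigh_bounds(1)[OF hE] that t unfolding N_def by (intro mult_left_mono) auto
    fix \<omega> assume "\<omega> \<in> {\<omega> \<in> space M. lambda_max m p (S \<omega>) \<ge> \<theta>}"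
    then have \<omega>: "\<omega> \<in> space M" "\<theta> \<le> lambda_max m p (S \<omega>)" by auto
    obtain x where "ip (m * p) x x = 1" "qf (m * p) (bcf m p (S \<omega>)) x = lambda_max m p (S \<omega>)"
      using rayleigh_attained(1)[OF hS[OF \<omega>(1)] N'] by blast
    then show "\<omega> \<in> space M \<and> (\<exists>x. ip N x x = 1 \<and> t * \<theta> \<le> t * ((\<Sum>i<n. qf N (\<phi> (V i \<omega>)) x) / real n))"
      unfolding qS[OF \<omega>(1)] unfolding N_def using \<omega> t by (metis mult_left_mono)
  qed
  moreover have "measure M {\<omega> \<in> space M. lambda_min m p (S \<omega>) \<le> \<theta>}
      \<le> real N * (exp (- (t * \<theta>)) * (1 + (exp t - 1) * lambda_min m p Emean)) ^ n"
    if t: "t \<le> 0" for t \<theta>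
  proof (rule laplace)
    show "t * qf (m * p) (bcf m p Emean) x \<le> t * lambda_min m p Emean" if "ip N x x = 1" for x
      using rayleigh_bounds(2)[OF hE] that t unfolding N_def by (intro mult_left_mono_neg) auto
    fix \<omega> assume "\<omega> \<in> {\<omega> \<in> space M. lambda_min m p (S \<omega>) \<le> \<theta>}"
    then have \<omega>: "\<omega> \<in> space M" "lambda_min m p (S \<omega>) \<le> \<theta>" by auto
    obtain x where "ip (m * p) x x = 1" "qf (m * p) (bcf m p (S \<omega>)) x = lambda_min m p (S \<omega>)"
      using rayleigh_attained(2)[OF hS[OF \<omega>(1)] N'] by blast
    then show "\<omega> \<in> space M \<and> (\<exists>x. ip N x x = 1 \<and> t * \<theta> \<le> t * ((\<Sum>i<n. qf N (\<phi> (V i \<omega>)) x) / real n))"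
      unfolding qS[OF \<omega>(1)] unfolding N_def using \<omega> t by (metis mult_left_mono_neg)
  qed
  ultimately show ?thesis
    unfolding N_def using max0 min1 n
    by (intro conjI allI impI chernoff_optimize_upper chernoff_optimize_lower) auto
qed

end
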